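(* Let $h\colon\mathbb{N}\to[1,\infty)$ with $h(n)\to\infty$ and let $M_n^{(p_k,z_k)_k}$ be the randomized algorithm defined in the context, with $N=2\lceil h(n)\log_2 n\rceil+1$. Let $\alpha>1/2$, let $\gamma=(\gamma_u)_u$ be weights with $0<\gamma_u\le1$, $d\in\mathbb{N}$, $n\ge2$ and $\tau\in(1/2,1)$. Then, with probability at least $1-\frac12(4\tau(1-\tau))^{N/2}$ over the choice of $(p_k,z_k)_{k=1}^N$, $$e^{\rm det}_{d,\alpha,\gamma}(M_n^{(p_k,z_k)_k})\le\inf_{1/2\le\lambda<\alpha}\Big(\frac{4\sqrt2}{(1-\tau)n}V_d(\alpha/\lambda,\gamma^{1/\lambda})\Big)^{\lambda}.$$
   Context: $\{1:m\}:=\{1,\ldots,m\}$. Weights $\gamma=(\gamma_u)_u$ indexed by finite $u\subset\mathbb{N}$, $0<\gamma_u\le1$, $\gamma_\emptyset=1$. For $h\in\mathbb{Z}^d$, $\mathrm{supp}(h)=\{j:h_j\ne0\}$, $r_{d,\alpha,\gamma}(h)=\gamma_{\mathrm{supp}(h)}^{-1}\prod_{j\in\mathrm{supp}(h)}|h_j|^\alpha$. The weighted Korobov space $\mathcal{H}_{d,\alpha,\gamma}$ consists of $f\colon[0,1]^d\to\mathbb{C}$ with absolutely convergent Fourier series $f=\sum_h\hat f(h)e^{2\pi ih\cdot x}$ and finite norm $\|f\|_{d,\alpha,\gamma}^2=\sum_h r_{d,\alpha,\gamma}(h)^2|\hat f(h)|^2$. $I_d(f)=\int_{[0,1]^d}f$.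 Lattice rule $Q_p^z(f)=\frac1p\sum_{k=0}^{p-1}f(\{kz/p\})$ with $\{\cdot\}$ the componentwise fractional part. For a deterministic rule $A$, $e^{\rm det}_{d,\alpha,\gamma}(A)=\sup_{\|f\|_{d,\alpha,\gamma}\le1}|I_d(f)-A(f)|$. $V_d(\alpha/\lambda,\gamma^{1/\lambda})=\sum_{\emptyset\ne u\subseteq\{1:d\}}\gamma_u^{1/\lambda}(2\zeta(\alpha/\lambda))^{|u|}$ with $\zeta$ the Riemann zeta function. Algorithm: $\mathcal{P}_n$ is the set of primes in $[\lceil n/2\rceil+1,n]$. For $k=1,\ldots,N$ independently, choose $p_k$ uniformly from $\mathcal{P}_n$ and then $z_k$ uniformly from $\{1:p_k-1\}^d$; for fixed $(p_k,z_k)_k$ the deterministic rule is $M_n^{(p_k,z_k)_k}(f)=\mathrm{median}\{Q_{p_k}^{z_k}(f):1\le k\le N\}$, where the median of complex numbers is taken separately for real and imaginary parts. *)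

theory Defs
  imports "HOL-Probability.Probability"
begin

text \<open>Coordinates are indexed by {1..d}. A frequency vector h in Z^d is a function
  nat => int vanishing outside {1..d}; a point of [0,1]^d is an extensional function
  nat => real on {1..d} (undefined outside), as produced by PiE / PiM.\<close>

definition Zd :: "nat \<Rightarrow> (nat \<Rightarrow> int) set" where
  "Zd d = {h. \<forall>j. j \<notin> {1..d} \<longrightarrow> h j = 0}"

definition supp :: "nat \<Rightarrow> (nat \<Rightarrow> int) \<Rightarrow> nat set" where
  "supp d h = {j \<in> {1..d}. h j \<noteq> 0}"

definition dotp :: "nat \<Rightarrow> (nat \<Rightarrow> int) \<Rightarrow> (nat \<Rightarrow> real) \<Rightarrow> real" where
  "dotp d h x = (\<Sum>j\<in>{1..d}. real_of_int (h j) * x j)"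

definition expo :: "nat \<Rightarrow> (nat \<Rightarrow> int) \<Rightarrow> (nat \<Rightarrow> real) \<Rightarrow> complex" where
  "expo d h x = cis (2 * pi * dotp d h x)"

definition cube_measure :: "nat \<Rightarrow> (nat \<Rightarrow> real) measure" where
  "cube_measure d = PiM {1..d} (\<lambda>_. restrict_space lborel {0..1::real})"

definition cube :: "nat \<Rightarrow> (nat \<Rightarrow> real) set" where
  "cube d = PiE {1..d} (\<lambda>_. {0..1::real})"

definition Int_d :: "nat \<Rightarrow> ((nat \<Rightarrow> real) \<Rightarrow> complex) \<Rightarrow> complex" where
  "Int_d d f = integral\<^sup>L (cube_measure d) f"

definition fcoeff :: "nat \<Rightarrow> ((nat \<Rightarrow> real) \<Rightarrow> complex) \<Rightarrow> (nat \<Rightarrow> int) \<Rightarrow> complex" where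
  "fcoeff d f h = integral\<^sup>L (cube_measure d) (\<lambda>x. f x * cnj (expo d h x))"

definition r_weight :: "nat \<Rightarrow> real \<Rightarrow> (nat set \<Rightarrow> real) \<Rightarrow> (nat \<Rightarrow> int) \<Rightarrow> real" where
  "r_weight d \<alpha> \<gamma> h = inverse (\<gamma> (supp d h)) * (\<Prod>j\<in>supp d h. \<bar>real_of_int (h j)\<bar> powr \<alpha>)"

definition kor_norm_sq :: "nat \<Rightarrow> real \<Rightarrow> (nat set \<Rightarrow> real) \<Rightarrow> ((nat \<Rightarrow> real) \<Rightarrow> complex) \<Rightarrow> real" where
  "kor_norm_sq d \<alpha> \<gamma> f = (\<Sum>\<^sub>\<infinity>h\<in>Zd d. (r_weight d \<alpha> \<gamma> h)\<^sup>2 * (cmod (fcoeff d f h))\<^sup>2)"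

definition korobov :: "nat \<Rightarrow> real \<Rightarrow> (nat set \<Rightarrow> real) \<Rightarrow> ((nat \<Rightarrow> real) \<Rightarrow> complex) \<Rightarrow> bool" where
  "korobov d \<alpha> \<gamma> f \<longleftrightarrow>
     (\<lambda>h. cmod (fcoeff d f h)) summable_on Zd d \<and>
     (\<forall>x\<in>cube d. ((\<lambda>h. fcoeff d f h * expo d h x) has_sum f x) (Zd d)) \<and>
     (\<lambda>h. (r_weight d \<alpha> \<gamma> h)\<^sup>2 * (cmod (fcoeff d f h))\<^sup>2) summable_on Zd d"

definition e_det :: "nat \<Rightarrow> real \<Rightarrow> (nat set \<Rightarrow> real) \<Rightarrow> (((nat \<Rightarrow> real) \<Rightarrow> complex) \<Rightarrow> complex) \<Rightarrow> ereal" where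
  "e_det d \<alpha> \<gamma> A = (SUP f\<in>{f. korobov d \<alpha> \<gamma> f \<and> kor_norm_sq d \<alpha> \<gamma> f \<le> 1}.
                         ereal (cmod (Int_d d f - A f)))"

definition zeta_r :: "real \<Rightarrow> real" where
  "zeta_r s = (\<Sum>n. 1 / real (Suc n) powr s)"

definition V_d :: "nat \<Rightarrow> real \<Rightarrow> (nat set \<Rightarrow> real) \<Rightarrow> real" where
  "V_d d s \<gamma> = (\<Sum>u\<in>{u. u \<subseteq> {1..d} \<and> u \<noteq> {}}. \<gamma> u * (2 * zeta_r s) ^ card u)"

definition lattice_rule :: "nat \<Rightarrow> nat \<Rightarrow> (nat \<Rightarrow> nat) \<Rightarrow> ((nat \<Rightarrow> real) \<Rightarrow> complex) \<Rightarrow> complex" where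
  "lattice_rule d p z f =
     (\<Sum>k<p. f (restrict (\<lambda>j. frac (real k * real (z j) / real p)) {1..d})) / of_nat p"

text \<open>Median of a list of reals of odd length: the middle element of the sorted list.
  (The algorithm only uses lists of odd length.)\<close>
definition median_r :: "real list \<Rightarrow> real" where
  "median_r xs = sort xs ! (length xs div 2)"

definition median_c :: "complex list \<Rightarrow> complex" where
  "median_c xs = Complex (median_r (map Re xs)) (median_r (map Im xs))"

definition primes_P :: "nat \<Rightarrow> nat set" where
  "primes_P n = {p. prime p \<and> nat \<lceil>real n / 2\<rceil> + 1 \<le> p \<and> p \<le> n}"

definition pair_pmf :: "nat \<Rightarrow> nat \<Rightarrow> (nat \<times> (nat \<Rightarrow> nat)) pmf" where
  "pair_pmf n d = do { p \<leftarrow> pmf_of_set (primes_P n);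
                       z \<leftarrow> pmf_of_set (PiE {1..d} (\<lambda>_. {1..p - 1}));
                       return_pmf (p, z) }"

definition sample_pmf :: "nat \<Rightarrow> nat \<Rightarrow> nat \<Rightarrow> (nat \<Rightarrow> nat \<times> (nat \<Rightarrow> nat)) pmf" where
  "sample_pmf N n d = Pi_pmf {1..N} (0, \<lambda>_. 0) (\<lambda>_. pair_pmf n d)"

definition median_rule :: "nat \<Rightarrow> nat \<Rightarrow> (nat \<Rightarrow> nat \<times> (nat \<Rightarrow> nat)) \<Rightarrow> ((nat \<Rightarrow> real) \<Rightarrow> complex) \<Rightarrow> complex" where
  "median_rule d N \<omega> f = median_c (map (\<lambda>k. lattice_rule d (fst (\<omega> k)) (snd (\<omega> k)) f) [1..<N+1])"

definition N_rep :: "(nat \<Rightarrow> real) \<Rightarrow> nat \<Rightarrow> nat" where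
  "N_rep h n = nat (2 * \<lceil>h n * log 2 (real n)\<rceil> + 1)"

end

theory Submission
  imports Defs "HOL-Library.Real_Mod"
begin

text \<open>
  On the unit ball of the Korobov space the error of the rule with modulus \<open>p\<close> and generator \<open>z\<close>
  is at most \<open>sqrt T\<close>, where \<open>T\<close> is the sum of \<open>r h powr (-2)\<close> over the nonzero dual vectors,
  those with \<open>p\<close> dividing the inner product of \<open>h\<close> and \<open>z\<close>. For \<open>lam \<ge> 1/2\<close> we have
  \<open>sqrt T \<le> S powr lam\<close>, where \<open>S\<close> sums \<open>r h powr (-1/lam)\<close> over the same vectors. Freeze all
  coordinates of \<open>h\<close> and \<open>z\<close> except one in the support of \<open>h\<close>; the sum over this remaining
  coordinate of \<open>h\<close> and of \<open>z\<close> is at most \<open>2 * zeta (\<alpha>/lam)\<close>, so the mean of \<open>S\<close> over \<open>z\<close> is at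
  most \<open>V / (p - 1) \<le> 2 * V / n\<close>. By Markov's inequality a single rule is bad with probability at
  most \<open>1 - \<tau>\<close>, and a binomial tail bound shows that with the claimed probability a majority of the
  rules is good, which carries over to the median. Taking real and imaginary parts separately costs
  a factor \<open>sqrt 2 \<le> (2 * sqrt 2) powr lam\<close>; this is affordable for \<open>lam < 1\<close> only because the mean
  bound has the constant 2 and not 4.

  The support of the sampling distribution is finite, so the infimum over \<open>lam\<close> can be replaced by
  a single \<open>lam\<close> when bounding the probability of a bad rule. That the set of primes to sample from
  is nonempty is Bertrand's postulate.
\<close>

section \<open>Bertrand's postulate\<close>

lemma prod_primes_dvd:
  fixes n :: nat
  assumes "finite A" "\<And>p. p \<in> A \<Longrightarrow> prime p \<and> p dvd n"
  shows "\<Prod>A dvd n"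
  using assms
proof (induction A rule: finite_induct)
  case (insert p A)
  have "coprime p (\<Prod>A)"
    using insert by (intro prod_coprime_right) (metis insertI1 insertI2 primes_coprime)
  thus ?case using insert by (auto intro: divides_mult)
qed auto

text \<open>The two middle entries of row \<open>2 * m + 1\<close> are equal, and together they are
  at most the row sum \<open>2 * 4 ^ m\<close>.\<close>

lemma binomial_odd_middle_le: "(2 * m + 1) choose m \<le> 4 ^ m"
proof -
  have "2 * ((2 * m + 1) choose m) = (\<Sum>k\<in>{m, m+1}. (2 * m + 1) choose k)"
    using binomial_symmetric[of m "2*m+1"] by simp
  also have "\<dots> \<le> (\<Sum>k\<le>2*m+1. (2 * m + 1) choose k)"
    by (intro sum_mono2) auto
  also have "\<dots> = 2 * 4 ^ m"
    using choose_row_sum[of "2*m+1"] by (simp add: power_mult)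
  finally show ?thesis by simp
qed

text \<open>Even \<open>n > 2\<close> is not prime, so nothing is gained over \<open>n - 1\<close>.
  For \<open>n = 2 * m + 1\<close> the primes in (m + 1, n] all divide \<open>n choose m\<close>, so
  their product is at most \<open>4 ^ m\<close>, and the induction hypothesis at
  \<open>m + 1\<close> covers the rest.\<close>

lemma primorial_le: "\<Prod>{p::nat. prime p \<and> p \<le> n} \<le> 4 ^ n"
proof (induction n rule: less_induct)
  case (less n)
  consider "n \<le> 1" | "n = 2" | "n > 2" "even n" | m where "n = 2 * m + 1" "m \<ge> 1"
  proof -
    assume *: "n \<le> 1 \<Longrightarrow> thesis" "n = 2 \<Longrightarrow> thesis" "2 < n \<Longrightarrow> even n \<Longrightarrow> thesis"
      "\<And>m. n = 2 * m + 1 \<Longrightarrow> m \<ge> 1 \<Longrightarrow> thesis"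
    show thesis
    proof (cases "n \<le> 2 \<or> even n")
      case True thus ?thesis using * by (cases "n \<le> 1"; cases "n = 2") auto
    next
      case False
      then obtain m where "n = 2 * m + 1" by (auto elim: oddE)
      with False show ?thesis using *(4)[of m] by auto
    qed
  qed
  thus ?case
  proof cases
    case 1
    hence "{p::nat. prime p \<and> p \<le> n} = {}" by (auto dest: prime_ge_2_nat)
    thus ?thesis by (simp only: prod.empty) simp
  next
    case 2
    hence "{p::nat. prime p \<and> p \<le> n} = {2}" by (auto dest: prime_ge_2_nat)
    hence "\<Prod>{p::nat. prime p \<and> p \<le> n} = 2" by (simp only: prod.insert prod.empty finite.emptyI) simp
    thus ?thesis using 2 by simp
  next
    case 3
    have "\<not> prime n" using 3 prime_nat_iff[of n] by auto
    hence "{p::nat. prime p \<and> p \<le> n} = {p. prime p \<and> p \<le> n - 1}"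
      using 3 by (auto simp: le_less)
    hence "\<Prod>{p::nat. prime p \<and> p \<le> n} \<le> 4 ^ (n - 1)" using less[of "n-1"] 3 by simp
    also have "\<dots> \<le> 4 ^ n" by (intro power_increasing) auto
    finally show ?thesis .
  next
    case (4 m)
    let ?B = "{p::nat. prime p \<and> m + 1 < p \<and> p \<le> 2 * m + 1}"
    have "\<Prod>?B dvd ((2 * m + 1) choose m)"
    proof (rule prod_primes_dvd)
      fix p assume p: "p \<in> ?B"
      have "p dvd fact (2 * m + 1)" using p by (simp add: prime_dvd_fact_iff del: fact_Suc)
      also have "fact (2 * m + 1) = fact m * fact (m + 1) * ((2 * m + 1) choose m)"
        using binomial_fact_lemma[of m "2*m+1"] by simp
      finally show "prime p \<and> p dvd ((2 * m + 1) choose m)"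
        using p prime_dvd_fact_iff[of p m] prime_dvd_fact_iff[of p "m+1"]
        by (auto simp: prime_dvd_mult_iff simp del: fact_Suc)
    qed auto
    hence "\<Prod>?B \<le> 4 ^ m"
      using binomial_odd_middle_le[of m] dvd_imp_le[of "\<Prod>?B" "(2 * m + 1) choose m"]
      by (force simp del: binomial_Suc_Suc intro: order_trans)
    moreover have "\<Prod>{p::nat. prime p \<and> p \<le> m + 1} \<le> 4 ^ (m + 1)" using less[of "m+1"] 4 by auto
    moreover have "{p::nat. prime p \<and> p \<le> n} = {p. prime p \<and> p \<le> m + 1} \<union> ?B" using 4 by auto
    ultimately have "\<Prod>{p::nat. prime p \<and> p \<le> n} \<le> 4 ^ (m + 1) * 4 ^ m"
      by (simp only:) (subst prod.union_disjoint, auto intro!: mult_mono)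
    also have "\<dots> = 4 ^ n" using 4 by (simp flip: power_add)
    finally show ?thesis .
  qed
qed

text \<open>The reciprocals of the numbers \<open>n * ((n - 1) choose j)\<close> form Leibniz's harmonic triangle,
  in which the entry \<open>(n, j + 1)\<close> is the difference of the entries \<open>(n - 1, j)\<close> and \<open>(n, j)\<close>.\<close>

lemma times_binomial_dvd_Lcm: "j < n \<Longrightarrow> n * ((n - 1) choose j) dvd Lcm {1..n}"
proof (induction j arbitrary: n)
  case 0
  thus ?case by (auto intro!: dvd_Lcm)
next
  case (Suc j)
  obtain N where n: "n = Suc N" "j < N" using Suc.prems by (cases n) auto
  let ?M = "int (Lcm {1..n})"
  define A B D where "A = int (n * (N choose j))" and "B = int (N * ((N - 1) choose j))"
    and "D = int (n * (N choose Suc j))"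
  have "Lcm {1..N} dvd Lcm {1..n}" using n by (intro Lcm_subset) auto
  with Suc.IH[of N] n have "N * ((N - 1) choose j) dvd Lcm {1..n}" using dvd_trans by blast
  then obtain b where b: "?M = b * B" unfolding B_def by (metis dvdE int_dvd_int_iff mult.commute)
  obtain a where a: "?M = a * A" unfolding A_def using Suc.IH[of n] n
    by (metis dvdE int_dvd_int_iff mult.commute less_Suc_eq diff_Suc_1)
  have B': "B = int (Suc j) * int (N choose Suc j)"
  proof -
    obtain K where "N = Suc K" using n by (cases N) auto
    thus ?thesis unfolding B_def using Suc_times_binomial_eq[of K j]
      by (metis diff_Suc_1 mult.commute of_nat_mult)
  qed
  have B'': "B = (int N - int j) * int (N choose j)"
    unfolding B' using n binomial_absorb_comp[of N j] binomial_absorption[of j N]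
    by (metis (no_types, lifting) less_imp_le of_nat_diff of_nat_mult)
  \<comment> \<open>This is 1/D = 1/B - 1/A cleared of denominators. Multiplying by
    \<open>?M = a * A = b * B\<close> gives \<open>?M\<close> / D = b - a, an integer.\<close>
  have AB: "A * B = D * (A - B)"
  proof -
    have "A - B = int (Suc j) * int (N choose j)"
      unfolding B'' A_def using n by (simp add: algebra_simps)
    hence "D * (A - B) = int n * int (N choose j) * (int (Suc j) * int (N choose Suc j))"
      unfolding D_def by (simp only: of_nat_mult mult_ac)
    thus ?thesis unfolding B'[symmetric] by (simp add: A_def)
  qed
  have nz: "A \<noteq> 0" "B \<noteq> 0" using n by (auto simp: A_def B_def simp del: mult_Suc of_nat_Suc)
  have "(b - a) * D * (A * B) = D * (A * (b * B) - B * (a * A))" by (simp add: algebra_simps)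
  also have "\<dots> = ?M * (A * B)" unfolding a[symmetric] b[symmetric] AB by (simp add: algebra_simps)
  finally have "?M = (b - a) * D" using nz by simp
  hence "D dvd ?M" by simp
  thus ?case unfolding D_def using n by (simp only: int_dvd_int_iff) simp
qed

section \<open>Prime powers dividing binomial coefficients\<close>

lemma prime_power_dvd_lcm_nat:
  fixes p :: nat
  assumes "prime p" "p ^ k dvd lcm a b"
  shows "p ^ k dvd a \<or> p ^ k dvd b"
proof (cases "a = 0 \<or> b = 0")
  case False
  have nu: "\<not> is_unit p" using assms(1) not_prime_unit by blast
  from False have "k \<le> multiplicity p (lcm a b)"
    using assms nu by (subst power_dvd_iff_le_multiplicity[symmetric]) (auto simp: lcm_eq_0_iff)
  also have "\<dots> = max (multiplicity p a) (multiplicity p b)"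
    using False assms(1) by (intro multiplicity_lcm) auto
  finally show ?thesis
    by (auto simp: max_def multiplicity_dvd' split: if_splits)
qed auto

lemma prime_power_dvd_Lcm_nat:
  fixes p :: nat
  assumes "finite A" "prime p" "p ^ k dvd Lcm A" "k > 0"
  shows "\<exists>a\<in>A. p ^ k dvd a"
  using assms(1,3)
proof (induction A rule: finite_induct)
  case empty
  thus ?case using assms by (auto simp: prime_nat_iff)
next
  case (insert a A)
  thus ?case using prime_power_dvd_lcm_nat[OF assms(2), of k a "Lcm A"] by auto
qed

text \<open>By Leibniz's triangle the binomial coefficient divides the lcm of 1, ..., n, and a prime
  power dividing an lcm divides one of its arguments. This gives the bound usually read off from
  Legendre's formula.\<close>

lemma prime_power_dvd_binomial_le:
  fixes p :: nat
  assumes "prime p" "p ^ k dvd (n choose j)" "j \<le> n" "n > 0"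
  shows "p ^ k \<le> n"
proof (cases "k = 0")
  case False
  have "(n choose j) dvd Lcm {1..n}"
  proof (cases j)
    case (Suc i)
    obtain N where N: "n = Suc N" using assms by (cases n) auto
    have "(n choose j) dvd Suc i * (n choose Suc i)" using Suc by simp
    also have "\<dots> = n * ((n - 1) choose i)"
      using Suc_times_binomial_eq[of N i] N by simp
    also have "\<dots> dvd Lcm {1..n}" using Suc assms by (intro times_binomial_dvd_Lcm) auto
    finally show ?thesis .
  qed auto
  hence "p ^ k dvd Lcm {1..n}" using assms dvd_trans by blast
  then obtain a where "a \<in> {1..n}" "p ^ k dvd a"
    using prime_power_dvd_Lcm_nat[of "{1..n}" p k] False assms by auto
  thus ?thesis using dvd_imp_le[of "p ^ k" a] by auto
qed (use assms in auto)

text \<open>The only multiple of \<open>p\<close> among the factors 1, ..., p + i is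
  \<open>p\<close> itself.\<close>

lemma not_prime_square_dvd_fact:
  fixes p :: nat
  assumes "prime p" "i < p"
  shows "\<not> p ^ 2 dvd fact (p + i)"
  using assms(2)
proof (induction i)
  case 0
  have "\<not> p dvd fact (p - 1)" using assms prime_gt_0_nat[of p] by (simp add: prime_dvd_fact_iff)
  moreover have "(fact p :: nat) = p * fact (p - 1)" using assms fact_reduce by (metis of_nat_id prime_gt_0_nat)
  ultimately show ?case using prime_gt_0_nat[OF assms(1)] by (simp add: power2_eq_square)
next
  case (Suc i)
  have "\<not> p dvd (p + Suc i)" using Suc.prems dvd_imp_le[of p "Suc i"]
    by (simp only: dvd_add_triv_left_iff) linarith
  hence "coprime p (p + Suc i)" using assms by (intro prime_imp_coprime)
  hence "coprime (p ^ 2) (p + Suc i)" by simp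
  thus ?case using Suc by (auto simp: coprime_dvd_mult_right_iff simp del: mult_Suc)
qed

text \<open>The multiples of \<open>p\<close> among 1, ..., 2p + i are \<open>p\<close> and
  \<open>2 * p\<close>, and \<open>2 * p\<close> contributes a single factor \<open>p\<close>
  because \<open>p\<close> is odd.\<close>

lemma not_prime_cube_dvd_fact:
  fixes p :: nat
  assumes "prime p" "p > 2" "i < p"
  shows "\<not> p ^ 3 dvd fact (2 * p + i)"
  using assms(3)
proof (induction i)
  case 0
  have p: "p > 0" using assms by simp
  have "\<not> p ^ 2 dvd fact (p + (p - 1))" using assms by (intro not_prime_square_dvd_fact) auto
  moreover have "p + (p - 1) = 2 * p - 1" using p by simp
  ultimately have 1: "\<not> p ^ 2 dvd fact (2 * p - 1)" by simp
  have "\<not> p dvd 2" using assms by (auto dest: dvd_imp_le)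
  hence "coprime p 2" using assms by (intro prime_imp_coprime)
  hence "coprime (p ^ 2) 2" by simp
  with 1 have 2: "\<not> p ^ 2 dvd 2 * fact (2 * p - 1)" by (simp add: coprime_dvd_mult_right_iff)
  have "(fact (2 * p) :: nat) = p * (2 * fact (2 * p - 1))"
    using fact_reduce[of "2 * p", where ?'a=nat] p by simp
  moreover have "p ^ 3 = p * p ^ 2" by (simp add: power3_eq_cube power2_eq_square)
  ultimately show ?case using 2 p by simp
next
  case (Suc i)
  have "\<not> p dvd (2 * p + Suc i)" using Suc.prems dvd_imp_le[of p "Suc i"]
    by (metis Suc_neq_Zero dvd_add_times_triv_left_iff leD mult.commute zero_less_Suc)
  hence "coprime p (2 * p + Suc i)" using assms by (intro prime_imp_coprime)
  hence "coprime (p ^ 3) (2 * p + Suc i)" by simp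
  thus ?case using Suc by (auto simp: coprime_dvd_mult_right_iff simp del: mult_Suc)
qed

text \<open>Both factors \<open>p\<close> of (2m)! are already used up by the two copies of m! in
  the denominator.\<close>

lemma prime_not_dvd_central_binomial:
  fixes p m :: nat
  assumes "prime p" "p > 2" "p \<le> m" "2 * m < 3 * p"
  shows "\<not> p dvd ((2 * m) choose m)"
proof
  assume "p dvd ((2 * m) choose m)"
  moreover have "p dvd fact m" using assms by (simp add: prime_dvd_fact_iff)
  ultimately have "p * p * p dvd fact m * fact m * ((2 * m) choose m)" by (intro mult_dvd_mono)
  also have "\<dots> = fact (2 * m)" using binomial_fact_lemma[of m "2 * m"] by simp
  finally have "p ^ 3 dvd fact (2 * p + (2 * m - 2 * p))"
    using assms by (simp add: power3_eq_cube)
  thus False using not_prime_cube_dvd_fact[of p "2 * m - 2 * p"] assms by force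
qed

lemma twelve_mult_less_power2: "k \<ge> 7 \<Longrightarrow> 12 * (k + 1) < (2::nat) ^ k"
  by (induction k rule: dec_induct) auto

text \<open>Erdos's argument. Without a prime in (m, 2m] every prime factor of the central binomial
  coefficient is at most 2m/3. The primes below \<open>q\<close> contribute at most
  \<open>2 * m\<close> each, the others occur only once and are controlled by
  \<open>primorial_le\<close>. This is too little for the lower bound 4^m / (2m).\<close>

lemma Bertrand_large:
  assumes "m \<ge> 8192"
  shows "\<exists>p::nat. prime p \<and> m < p \<and> p \<le> 2 * m"
proof (rule ccontr)
  assume no: "\<not> ?thesis"
  define C where "C = (2 * m) choose m"
  have C0: "C > 0" by (simp add: C_def)
  \<comment> \<open>Bracketing \<open>2 * m\<close> between powers of 4 avoids roots and logarithms:
    \<open>q = 2 ^ (k + 1)\<close> is an integer substitute for the square root of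
    \<open>2 * m\<close>, and \<open>q ^ 2 > 2 * m\<close>.\<close>
  obtain k where k: "4 ^ k \<le> 2 * m" "2 * m < 4 ^ (k + 1)"
    using ex_power_ivl1[of 4 "2 * m"] assms by auto
  \<comment> \<open>The threshold 8192 is half of 4^7; from \<open>k = 7\<close> on,
    \<open>2 ^ k\<close> exceeds \<open>12 * (k + 1)\<close>.\<close>
  have k7: "k \<ge> 7"
  proof (rule ccontr)
    assume "\<not> ?thesis"
    hence "(4::nat) ^ (k + 1) \<le> 4 ^ 7" by (intro power_increasing) auto
    thus False using k assms by simp
  qed
  define q :: nat where "q = 2 ^ (k + 1)"
  have q2: "q ^ 2 = 4 ^ (k + 1)" unfolding q_def by (simp only: power2_eq_square power_mult_distrib[symmetric]) (simp)
  have small: "p \<le> 2 * m div 3" if "p \<in> prime_factors C" for p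
  proof -
    have p: "prime p" "p dvd C" using that by auto
    have "p dvd fact (2 * m)" using p(2) binomial_fact_lemma[of m "2 * m"] unfolding C_def
      by (metis dvd_mult le_add1 mult_2)
    hence "p \<le> 2 * m" using p by (simp add: prime_dvd_fact_iff)
    with no p have "p \<le> m" by (meson not_less)
    show ?thesis
    proof (cases "p > 2 \<and> 2 * m < 3 * p")
      case True
      thus ?thesis using prime_not_dvd_central_binomial[of p m] p \<open>p \<le> m\<close> by (simp add: C_def)
    qed (use assms in auto)
  qed
  have pw: "p ^ multiplicity p C \<le> 2 * m" if "p \<in> prime_factors C" for p
    using that assms by (intro prime_power_dvd_binomial_le[of p _ _ m]) (auto simp: C_def multiplicity_dvd)
  have big: "p ^ multiplicity p C \<le> p" if "p \<in> prime_factors C" "q \<le> p" for p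
  proof -
    have p: "p > 1" using that by (auto simp: in_prime_factors_iff prime_gt_1_nat prime_gt_Suc_0_nat)
    have "multiplicity p C < 2"
    proof (rule ccontr)
      assume "\<not> ?thesis"
      hence "p ^ 2 \<le> p ^ multiplicity p C" using p by (intro power_increasing) auto
      also have "\<dots> \<le> 2 * m" by (rule pw) fact
      also have "\<dots> < q ^ 2" using k q2 by simp
      also have "\<dots> \<le> p ^ 2" using that by (intro power_mono) auto
      finally show False by simp
    qed
    thus ?thesis using p by (cases "multiplicity p C") auto
  qed
  let ?S = "{p\<in>prime_factors C. p < q}" and ?L = "{p\<in>prime_factors C. q \<le> p}"
  have "C = (\<Prod>p\<in>prime_factors C. p ^ multiplicity p C)"
    using C0 by (intro prime_factorization_nat) auto
  also have "prime_factors C = ?S \<union> ?L" by auto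
  also have "(\<Prod>p\<in>?S \<union> ?L. p ^ multiplicity p C)
      = (\<Prod>p\<in>?S. p ^ multiplicity p C) * (\<Prod>p\<in>?L. p ^ multiplicity p C)"
    by (intro prod.union_disjoint) auto
  also have "\<dots> \<le> (\<Prod>p\<in>?S. 2 * m) * (\<Prod>p\<in>?L. p)"
    by (intro mult_mono prod_mono) (auto intro: pw big)
  also have "\<dots> \<le> (2 * m) ^ (q - 1) * 4 ^ (2 * m div 3)"
  proof (intro mult_mono)
    \<comment> \<open>Leaving out 0 saves one factor \<open>2 * m\<close>, which later absorbs the
      denominator of the lower bound for \<open>C\<close>.\<close>
    have "?S \<subseteq> {1..<q}" by (auto simp: in_prime_factors_iff Suc_leI prime_gt_0_nat)
    hence "card ?S \<le> q - 1" using card_mono[of "{1..<q}" ?S] by simp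
    thus "(\<Prod>p\<in>?S. 2 * m) \<le> (2 * m) ^ (q - 1)"
      using assms unfolding prod_constant by (intro power_increasing) auto
    have "\<Prod>?L \<le> \<Prod>{p. prime p \<and> p \<le> 2 * m div 3}"
    proof (rule dvd_imp_le)
      show "\<Prod>?L dvd \<Prod>{p. prime p \<and> p \<le> 2 * m div 3}"
        using small by (intro prod_dvd_prod_subset) auto
    qed (auto intro!: prod_pos simp: prime_gt_0_nat)
    thus "\<Prod>?L \<le> 4 ^ (2 * m div 3)" using primorial_le[of "2 * m div 3"] by linarith
  qed auto
  finally have *: "C \<le> (2 * m) ^ (q - 1) * 4 ^ (2 * m div 3)" .
  have "4 ^ m \<le> 2 * m * C"
  proof -
    have "real (4 ^ m) / (2 * real m) \<le> real C"
      using central_binomial_lower_bound[of m] assms by (simp add: C_def)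
    hence "real (4 ^ m) \<le> real (2 * m * C)" using assms by (simp add: field_simps)
    thus ?thesis by (simp only: of_nat_le_iff)
  qed
  also have "\<dots> \<le> 2 * m * ((2 * m) ^ (q - 1) * 4 ^ (2 * m div 3))" using * by (intro mult_left_mono) auto
  also have "\<dots> = (2 * m) ^ q * 4 ^ (2 * m div 3)"
  proof -
    have "q = Suc (q - 1)" by (simp add: q_def)
    hence "(2 * m) ^ q = 2 * m * (2 * m) ^ (q - 1)" by (metis power_Suc)
    thus ?thesis by simp
  qed
  also have "\<dots> \<le> (4 ^ (k + 1)) ^ q * 4 ^ (2 * m div 3)"
    using k by (intro mult_right_mono power_mono) auto
  also have "\<dots> = 4 ^ ((k + 1) * q + 2 * m div 3)" by (simp only: power_mult power_add)
  finally have "m \<le> (k + 1) * q + 2 * m div 3"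
    by (subst (asm) power_increasing_iff) auto
  hence "m \<le> 3 * ((k + 1) * q)" by linarith
  hence "2 * m \<le> 12 * (k + 1) * 2 ^ k" by (simp add: q_def algebra_simps)
  hence "(2::nat) ^ k * 2 ^ k \<le> 12 * (k + 1) * 2 ^ k"
    using k(1) by (simp flip: power_mult_distrib)
  hence "2 ^ k \<le> 12 * (k + 1)" by simp
  thus False using twelve_mult_less_power2[OF k7] by simp
qed

text \<open>The candidate divisors form a list interval so that \<open>simp\<close> can evaluate the
  check for concrete numerals.\<close>

lemma prime_nat_trial_division:
  fixes p :: nat
  assumes "p > 1" "p < k * k" "\<forall>d\<in>set [2..<k]. \<not> d dvd p"
  shows "prime p"
proof (rule ccontr)
  assume "\<not> prime p"
  then obtain a where a: "a dvd p" "a \<noteq> 1" "a \<noteq> p" using assms(1) by (auto simp: prime_nat_iff)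
  then obtain b where b: "p = a * b" by blast
  have "a \<noteq> 0" "b \<noteq> 0" "b \<noteq> 1" using a b assms(1) by (auto intro!: Nat.gr0I)
  hence ge: "a \<ge> 2" "b \<ge> 2" using a by linarith+
  have "a < k \<or> b < k"
  proof (rule ccontr)
    assume "\<not> ?thesis"
    hence "k * k \<le> a * b" by (intro mult_mono) auto
    thus False using assms b by simp
  qed
  thus False using assms(3) ge a b by (metis atLeastLessThan_iff dvd_triv_left dvd_triv_right set_upt)
qed

text \<open>For small \<open>m\<close> a chain of primes, each less than twice its predecessor,
  suffices. If the claim fails at \<open>m\<close>, then a prime at most \<open>2 * m\<close> is at
  most \<open>m\<close>, so the lower bound on \<open>m\<close> climbs along the chain up to 9973,
  beyond 8192.\<close>

theorem Bertrand:
  assumes "m \<ge> 1"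
  shows "\<exists>p::nat. prime p \<and> m < p \<and> p \<le> 2 * m"
proof (rule ccontr)
  assume no: "\<not> ?thesis"
  hence small: "m < 8192" using Bertrand_large[of m] by (meson not_le)
  have step: "p \<le> m" if "prime p" "p \<le> 2 * m" for p
    using no that not_less by blast
  have p2: "prime (2::nat)" by (rule prime_nat_trial_division[of _ 2]; simp)
  have p3: "prime (3::nat)" by (rule prime_nat_trial_division[of _ 2]; simp)
  have p5: "prime (5::nat)" by (rule prime_nat_trial_division[of _ 3]; simp)
  have p7: "prime (7::nat)" by (rule prime_nat_trial_division[of _ 3]; simp)
  have p13: "prime (13::nat)" by (rule prime_nat_trial_division[of _ 4]; simp)
  have p23: "prime (23::nat)" by (rule prime_nat_trial_division[of _ 5]; simp)
  have p43: "prime (43::nat)" by (rule prime_nat_trial_division[of _ 7]; simp)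
  have p83: "prime (83::nat)" by (rule prime_nat_trial_division[of _ 10]; simp)
  have p163: "prime (163::nat)" by (rule prime_nat_trial_division[of _ 13]; simp)
  have p317: "prime (317::nat)" by (rule prime_nat_trial_division[of _ 18]; simp)
  have p631: "prime (631::nat)" by (rule prime_nat_trial_division[of _ 26]; simp)
  have p1259: "prime (1259::nat)" by (rule prime_nat_trial_division[of _ 36]; simp)
  have p2503: "prime (2503::nat)" by (rule prime_nat_trial_division[of _ 51]; simp)
  have p5003: "prime (5003::nat)" by (rule prime_nat_trial_division[of _ 71]; simp)
  have p9973: "prime (9973::nat)" by (rule prime_nat_trial_division[of _ 100]; simp)
  have m2: "2 \<le> m" using assms by (intro step p2) simp
  have m3: "3 \<le> m" using m2 by (intro step p3) simp
  have m5: "5 \<le> m" using m3 by (intro step p5) simp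
  have m7: "7 \<le> m" using m5 by (intro step p7) simp
  have m13: "13 \<le> m" using m7 by (intro step p13) simp
  have m23: "23 \<le> m" using m13 by (intro step p23) simp
  have m43: "43 \<le> m" using m23 by (intro step p43) simp
  have m83: "83 \<le> m" using m43 by (intro step p83) simp
  have m163: "163 \<le> m" using m83 by (intro step p163) simp
  have m317: "317 \<le> m" using m163 by (intro step p317) simp
  have m631: "631 \<le> m" using m317 by (intro step p631) simp
  have m1259: "1259 \<le> m" using m631 by (intro step p1259) simp
  have m2503: "2503 \<le> m" using m1259 by (intro step p2503) simp
  have m5003: "5003 \<le> m" using m2503 by (intro step p5003) simp
  have m9973: "9973 \<le> m" using m5003 by (intro step p9973) simp
  show False using m9973 small by simp
qed

section \<open>Sums over the dual lattice\<close>

text \<open>The sums over nonzero integers are approached through these finite boxes, with bounds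
  that do not depend on \<open>H\<close>.\<close>

definition nz_box :: "nat \<Rightarrow> int set" where
  "nz_box H = {- int H..int H} - {0}"

lemma finite_nz_box [simp]: "finite (nz_box H)"
  by (simp add: nz_box_def)

lemma summable_zeta_r:
  assumes "s > 1"
  shows "summable (\<lambda>n. 1 / real (Suc n) powr s)"
proof -
  have "summable (\<lambda>n. real n powr (-s))" using assms by (simp add: summable_real_powr_iff)
  hence "summable (\<lambda>n. real (Suc n) powr (-s))" by (subst summable_Suc_iff)
  thus ?thesis by (simp add: powr_minus_divide)
qed

lemma zeta_r_pos: "s > 1 \<Longrightarrow> zeta_r s > 0"
  unfolding zeta_r_def by (intro suminf_pos summable_zeta_r) auto

lemma sum_nz_box_powr_le:
  assumes "s > 1"
  shows "(\<Sum>a\<in>nz_box H. \<bar>real_of_int a\<bar> powr (-s)) \<le> 2 * zeta_r s"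
proof -
  have half: "(\<Sum>k\<in>{1..H}. real k powr (-s)) \<le> zeta_r s"
  proof -
    have "(\<Sum>k\<in>{1..H}. real k powr (-s)) = (\<Sum>k<H. 1 / real (Suc k) powr s)"
      by (rule sum.reindex_bij_witness[of _ Suc "\<lambda>k. k - 1"]) (auto simp: powr_minus_divide)
    also have "\<dots> \<le> zeta_r s" unfolding zeta_r_def
      by (intro sum_le_suminf summable_zeta_r assms) auto
    finally show ?thesis .
  qed
  have "nz_box H = int ` {1..H} \<union> (\<lambda>k. - int k) ` {1..H}"
  proof (intro set_eqI iffI)
    fix a assume "a \<in> nz_box H"
    thus "a \<in> int ` {1..H} \<union> (\<lambda>k. - int k) ` {1..H}"
      by (cases "a > 0") (auto simp: nz_box_def image_iff intro!: bexI[of _ "nat \<bar>a\<bar>"])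
  qed (auto simp: nz_box_def)
  moreover have "int ` {1..H} \<inter> (\<lambda>k. - int k) ` {1..H} = {}" by auto
  ultimately have "(\<Sum>a\<in>nz_box H. \<bar>real_of_int a\<bar> powr (-s))
     = (\<Sum>a\<in>int ` {1..H}. \<bar>real_of_int a\<bar> powr (-s))
       + (\<Sum>a\<in>(\<lambda>k. - int k) ` {1..H}. \<bar>real_of_int a\<bar> powr (-s))"
    by (simp add: sum.union_disjoint)
  also have "\<dots> = (\<Sum>k\<in>{1..H}. real k powr (-s)) + (\<Sum>k\<in>{1..H}. real k powr (-s))"
    by (subst (1 2) sum.reindex) (auto simp: inj_on_def)
  finally show ?thesis using half by linarith
qed

lemma sum_multiples_powr_le:
  assumes "s > 1" "p > 0"
  shows "(\<Sum>a | a \<in> nz_box H \<and> int p dvd a. \<bar>real_of_int a\<bar> powr (-s)) \<le> real p powr (-s) * (2 * zeta_r s)"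
proof -
  have sub: "{a \<in> nz_box H. int p dvd a} \<subseteq> (\<lambda>b. int p * b) ` nz_box H"
  proof
    fix a assume a: "a \<in> {a \<in> nz_box H. int p dvd a}"
    then obtain b where b: "a = int p * b" by blast
    have "\<bar>b\<bar> \<le> \<bar>a\<bar>" using assms by (simp add: b abs_mult mult_le_cancel_right1)
    hence "b \<in> nz_box H" using a b by (auto simp: nz_box_def)
    thus "a \<in> (\<lambda>b. int p * b) ` nz_box H" using b by blast
  qed
  have "(\<Sum>a | a \<in> nz_box H \<and> int p dvd a. \<bar>real_of_int a\<bar> powr (-s))
      \<le> (\<Sum>a\<in>(\<lambda>b. int p * b) ` nz_box H. \<bar>real_of_int a\<bar> powr (-s))"
    using sub by (intro sum_mono2) auto
  also have "\<dots> = (\<Sum>b\<in>nz_box H. \<bar>real_of_int (int p * b)\<bar> powr (-s))"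
    using assms by (subst sum.reindex) (auto simp: inj_on_def)
  also have "\<dots> = real p powr (-s) * (\<Sum>b\<in>nz_box H. \<bar>real_of_int b\<bar> powr (-s))"
    by (simp add: sum_distrib_left abs_mult powr_mult)
  also have "\<dots> \<le> real p powr (-s) * (2 * zeta_r s)"
    using assms by (intro mult_left_mono sum_nz_box_powr_le) auto
  finally show ?thesis .
qed

lemma sum_coordinate_le:
  fixes c :: int
  assumes p: "prime p" and s: "s > 1"
  shows "(\<Sum>a\<in>nz_box H. \<Sum>b\<in>{1..p - 1}.
            if int p dvd a * int b + c then \<bar>real_of_int a\<bar> powr (-s) else 0) \<le> 2 * zeta_r s"
proof (cases "int p dvd c")
  case True
  have p': "prime (int p)" using p by simp
  have p0: "p > 0" using p by (rule prime_gt_0_nat)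
  have iff: "int p dvd a * int b + c \<longleftrightarrow> int p dvd a" if "b \<in> {1..p - 1}" for a b
  proof -
    have "\<not> p dvd b" using that dvd_imp_le[of p b] by auto
    hence "\<not> int p dvd int b" by simp
    thus ?thesis using True p' by (simp add: dvd_add_left_iff prime_dvd_mult_iff)
  qed
  have "(\<Sum>a\<in>nz_box H. \<Sum>b\<in>{1..p - 1}.
            if int p dvd a * int b + c then \<bar>real_of_int a\<bar> powr (-s) else 0)
      = (\<Sum>a\<in>nz_box H. \<Sum>b\<in>{1..p - 1}. if int p dvd a then \<bar>real_of_int a\<bar> powr (-s) else 0)"
    using iff by (intro sum.cong refl) auto
  also have "\<dots> = real (p - 1) * (\<Sum>a | a \<in> nz_box H \<and> int p dvd a. \<bar>real_of_int a\<bar> powr (-s))"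
    by (simp add: sum.inter_filter sum_distrib_left)
  also have "\<dots> \<le> real p * (real p powr (-s) * (2 * zeta_r s))"
    using s p0 by (intro mult_mono sum_multiples_powr_le) (auto intro!: sum_nonneg)
  also have "\<dots> = real p powr (1 - s) * (2 * zeta_r s)"
    using p0 by (simp add: powr_diff powr_minus_divide)
  also have "\<dots> \<le> 1 * (2 * zeta_r s)"
    using s p0 zeta_r_pos[OF s] powr_mono[of "1 - s" 0 "real p"] by (intro mult_right_mono) auto
  finally show ?thesis by simp
next
  case False
  have p': "prime (int p)" using p by simp
  have "(\<Sum>b\<in>{1..p - 1}. if int p dvd a * int b + c then \<bar>real_of_int a\<bar> powr (-s) else 0)
        \<le> \<bar>real_of_int a\<bar> powr (-s)" for a
  proof -
    let ?B = "{b \<in> {1..p - 1}. int p dvd a * int b + c}"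
    have "b = b'" if "b \<in> ?B" "b' \<in> ?B" for b b'
    proof -
      have na: "\<not> int p dvd a"
        using that False by (metis (no_types, lifting) dvd_add_right_iff dvd_mult2 mem_Collect_eq)
      have "int p dvd (a * int b + c) - (a * int b' + c)" using that by (intro dvd_diff) auto
      also have "\<dots> = a * (int b - int b')" by (simp add: algebra_simps)
      finally have "int p dvd int b - int b'" using na p' by (simp add: prime_dvd_mult_iff)
      moreover have "\<bar>int b - int b'\<bar> < int p" using that by auto
      ultimately show ?thesis using zdvd_imp_le[of "int p" "\<bar>int b - int b'\<bar>"] by force
    qed
    hence "card ?B \<le> 1" by (subst One_nat_def, subst card_le_Suc0_iff_eq) auto
    hence "real (card ?B) * \<bar>real_of_int a\<bar> powr (-s) \<le> 1 * \<bar>real_of_int a\<bar> powr (-s)"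
      by (intro mult_right_mono) auto
    thus ?thesis by (simp flip: sum.inter_filter)
  qed
  thus ?thesis using sum_nz_box_powr_le[OF s, of H] by (meson order_trans sum_mono)
qed

section \<open>Frequencies with a fixed support\<close>

lemma sum_PiE_insert:
  assumes "x \<notin> A"
  shows "(\<Sum>g\<in>PiE (insert x A) S. F g) = (\<Sum>g\<in>PiE A S. \<Sum>a\<in>S x. F (g(x := a)))"
proof -
  have "(\<Sum>g\<in>PiE (insert x A) S. F g) = (\<Sum>(a, g)\<in>S x \<times> PiE A S. F (g(x := a)))"
    unfolding PiE_insert_eq using inj_combinator[OF assms, of S]
    by (subst sum.reindex) (auto simp: case_prod_unfold)
  also have "\<dots> = (\<Sum>g\<in>PiE A S. \<Sum>a\<in>S x. F (g(x := a)))"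
    by (subst sum.swap) (simp add: sum.cartesian_product)
  finally show ?thesis .
qed

text \<open>One coordinate \<open>j\<close> in \<open>u\<close> is split off from both
  \<open>g\<close> and \<open>z\<close>, and \<open>sum_coordinate_le\<close> is applied to it. The
  weights of the other coordinates factor into one-dimensional sums, and the other generator
  components are merely counted. The exponent \<open>card D - 1\<close> in place of
  \<open>card D\<close> is the gain 1/(p - 1) in the mean.\<close>

lemma sum_frequencies_generators_le:
  fixes u D :: "nat set"
  assumes p: "prime p" and s: "s > 1" and fin: "finite D" and u: "u \<subseteq> D" "u \<noteq> {}"
  shows "(\<Sum>g\<in>PiE u (\<lambda>_. nz_box H). \<Sum>z\<in>PiE D (\<lambda>_. {1..p - 1}).
            if int p dvd (\<Sum>i\<in>u. g i * int (z i)) then \<Prod>i\<in>u. \<bar>real_of_int (g i)\<bar> powr (-s) else 0)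
         \<le> (2 * zeta_r s) ^ card u * real ((p - 1) ^ (card D - 1))"
proof -
  obtain j where j: "j \<in> u" using u by blast
  define v E where "v = u - {j}" and "E = D - {j}"
  have uv: "u = insert j v" "j \<notin> v" "finite v" and DE: "D = insert j E" "j \<notin> E" "finite E"
    and vE: "v \<subseteq> E"
    using j u fin by (auto simp: v_def E_def intro: finite_subset)
  let ?P = "\<lambda>_::nat. {1..p - 1}" and ?B = "\<lambda>_::nat. nz_box H"
  let ?w = "\<lambda>g. \<Prod>i\<in>v. \<bar>real_of_int (g i)\<bar> powr (-s)"
  have z0: "2 * zeta_r s \<ge> 0" using zeta_r_pos[OF s] by simp
  have upd: "(\<Sum>i\<in>u. (g(j := a)) i * int ((z(j := b)) i)) = a * int b + (\<Sum>i\<in>v. g i * int (z i))"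
    for g z a b
    using uv by (simp add: sum.insert) (intro sum.cong refl, auto)
  have updp: "(\<Prod>i\<in>u. \<bar>real_of_int ((g(j := a)) i)\<bar> powr (-s)) = \<bar>real_of_int a\<bar> powr (-s) * ?w g" for g a
    using uv by (simp add: prod.insert) (intro disjI2 prod.cong refl, auto)
  have "(\<Sum>g\<in>PiE u ?B. \<Sum>z\<in>PiE D ?P.
            if int p dvd (\<Sum>i\<in>u. g i * int (z i)) then \<Prod>i\<in>u. \<bar>real_of_int (g i)\<bar> powr (-s) else 0)
     = (\<Sum>g\<in>PiE v ?B. \<Sum>a\<in>nz_box H. \<Sum>z\<in>PiE E ?P. \<Sum>b\<in>{1..p - 1}.
            if int p dvd (\<Sum>i\<in>u. (g(j := a)) i * int ((z(j := b)) i))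
            then \<Prod>i\<in>u. \<bar>real_of_int ((g(j := a)) i)\<bar> powr (-s) else 0)"
    unfolding uv(1) DE(1) sum_PiE_insert[OF uv(2)] sum_PiE_insert[OF DE(2)] ..
  also have "\<dots> = (\<Sum>g\<in>PiE v ?B. \<Sum>a\<in>nz_box H. \<Sum>z\<in>PiE E ?P. \<Sum>b\<in>{1..p - 1}.
            ?w g * (if int p dvd a * int b + (\<Sum>i\<in>v. g i * int (z i)) then \<bar>real_of_int a\<bar> powr (-s) else 0))"
    unfolding upd updp by (intro sum.cong refl) auto
  also have "\<dots> = (\<Sum>g\<in>PiE v ?B. \<Sum>z\<in>PiE E ?P. ?w g * (\<Sum>a\<in>nz_box H. \<Sum>b\<in>{1..p - 1}.
            if int p dvd a * int b + (\<Sum>i\<in>v. g i * int (z i)) then \<bar>real_of_int a\<bar> powr (-s) else 0))"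
    unfolding sum_distrib_left by (intro sum.cong refl) (rule sum.swap)
  also have "\<dots> \<le> (\<Sum>g\<in>PiE v ?B. \<Sum>z\<in>PiE E ?P. ?w g * (2 * zeta_r s))"
    by (intro sum_mono mult_left_mono sum_coordinate_le p s prod_nonneg) auto
  also have "\<dots> = real (card (PiE E ?P)) * (2 * zeta_r s) * (\<Sum>g\<in>PiE v ?B. ?w g)"
    by (simp add: sum_distrib_left mult_ac)
  also have "(\<Sum>g\<in>PiE v ?B. ?w g) = (\<Prod>i\<in>v. \<Sum>a\<in>nz_box H. \<bar>real_of_int a\<bar> powr (-s))"
    using uv by (subst prod_sum_PiE) auto
  also have "real (card (PiE E ?P)) * (2 * zeta_r s) * \<dots>
     \<le> real (card (PiE E ?P)) * (2 * zeta_r s) * (\<Prod>i\<in>v. 2 * zeta_r s)"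
    using z0 by (intro mult_left_mono prod_mono conjI sum_nz_box_powr_le s sum_nonneg mult_nonneg_nonneg) auto
  also have "\<dots> = (2 * zeta_r s) ^ card u * real ((p - 1) ^ (card D - 1))"
    using uv DE by (simp add: card_PiE)
  finally show ?thesis .
qed

section \<open>Passing to all nonzero frequencies, and the dual sum\<close>

abbreviation Zd_nz :: "nat \<Rightarrow> (nat \<Rightarrow> int) set" where
  "Zd_nz d \<equiv> Zd d - {\<lambda>_. 0}"

text \<open>A finite set of nonzero frequencies splits by support, and each class embeds into the
  box of its support. Both the summability and the mean bound are thereby reduced to one support at
  a time.\<close>

lemma sum_Zd_le_by_support:
  fixes \<Psi> :: "(nat \<Rightarrow> int) \<Rightarrow> real"
  assumes nn: "\<And>h. \<Psi> h \<ge> 0"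
    and bound: "\<And>u H. u \<subseteq> {1..d} \<Longrightarrow> u \<noteq> {} \<Longrightarrow>
       (\<Sum>g\<in>PiE u (\<lambda>_. nz_box H). \<Psi> (\<lambda>i. if i \<in> u then g i else 0)) \<le> C u"
    and F: "finite F" "F \<subseteq> Zd_nz d"
  shows "sum \<Psi> F \<le> (\<Sum>u\<in>{u. u \<subseteq> {1..d} \<and> u \<noteq> {}}. C u)"
proof -
  \<comment> \<open>Inserting 0 keeps \<open>Max\<close> meaningful when \<open>F\<close> is
    empty.\<close>
  define H where "H = Max (insert 0 ((\<lambda>(h, i). nat \<bar>h i\<bar>) ` (F \<times> {1..d})))"
  have H: "\<bar>h i\<bar> \<le> int H" if "h \<in> F" "i \<in> {1..d}" for h i
  proof -
    have "nat \<bar>h i\<bar> \<le> H" unfolding H_def using F that by (intro Max_ge) force+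
    thus ?thesis by linarith
  qed
  let ?U = "{u. u \<subseteq> {1..d} \<and> u \<noteq> {}}"
  let ?box = "\<lambda>u. (\<lambda>g i. if i \<in> u then g i else 0) ` PiE u (\<lambda>_. nz_box H)"
  have fin: "finite ?U" by simp
  have finb: "finite (?box u)" if "u \<in> ?U" for u
    using that by (intro finite_imageI finite_PiE) (auto intro: finite_subset)
  have supp_box: "h \<in> ?box (supp d h)" "supp d h \<in> ?U" if h: "h \<in> F" for h
  proof -
    have hZ: "\<And>i. i \<notin> {1..d} \<Longrightarrow> h i = 0" "h \<noteq> (\<lambda>_. 0)" using h F by (auto simp: Zd_def)
    show "supp d h \<in> ?U" using hZ by (auto simp: supp_def fun_eq_iff)
    have "h = (\<lambda>i. if i \<in> supp d h then restrict h (supp d h) i else 0)"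
      using hZ by (auto simp: supp_def fun_eq_iff)
    moreover have "restrict h (supp d h) \<in> PiE (supp d h) (\<lambda>_. nz_box H)"
    proof (intro PiE_I)
      fix i assume i: "i \<in> supp d h"
      hence "\<bar>h i\<bar> \<le> int H" "h i \<noteq> 0" using H[OF h] by (auto simp: supp_def)
      thus "restrict h (supp d h) i \<in> nz_box H" using i by (simp add: nz_box_def abs_le_iff)
    qed auto
    ultimately show "h \<in> ?box (supp d h)" by blast
  qed
  have "sum \<Psi> F = (\<Sum>u\<in>?U. sum \<Psi> {h \<in> F. supp d h = u})"
    using supp_box(2) F by (intro sum.group[symmetric]) auto
  also have "\<dots> \<le> (\<Sum>u\<in>?U. sum \<Psi> (?box u))"
    using supp_box(1) by (intro sum_mono sum_mono2 finb nn) auto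
  also have "\<dots> \<le> (\<Sum>u\<in>?U. C u)"
  proof (intro sum_mono)
    fix u assume u: "u \<in> ?U"
    have "inj_on (\<lambda>g i. if i \<in> u then g i else 0) (PiE u (\<lambda>_. nz_box H))"
    proof (intro inj_onI)
      fix g g' assume *: "g \<in> PiE u (\<lambda>_. nz_box H)" "g' \<in> PiE u (\<lambda>_. nz_box H)"
        "(\<lambda>i. if i \<in> u then g i else 0) = (\<lambda>i. if i \<in> u then g' i else 0)"
      show "g = g'" using *(1,2)
      proof (rule PiE_ext)
        fix i assume "i \<in> u"
        thus "g i = g' i" using fun_cong[OF *(3), of i] by simp
      qed
    qed
    thus "sum \<Psi> (?box u) \<le> C u" using bound[of u H] u by (simp add: sum.reindex o_def)
  qed
  finally show ?thesis .
qed

lemma r_weight_pos: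
  fixes d :: nat and \<alpha> :: real
  assumes "\<forall>u. finite u \<longrightarrow> 0 < \<gamma> u"
  shows "r_weight d \<alpha> \<gamma> h > 0"
  using assms unfolding r_weight_def by (intro mult_pos_pos prod_pos) (simp_all add: supp_def)

lemma r_weight_powr:
  assumes "\<forall>u. finite u \<longrightarrow> 0 < \<gamma> u"
  shows "r_weight d \<alpha> \<gamma> h powr (- (1 / lam))
    = \<gamma> (supp d h) powr (1 / lam) * (\<Prod>j\<in>supp d h. \<bar>real_of_int (h j)\<bar> powr (- (\<alpha> / lam)))"
proof -
  have "finite (supp d h)" by (simp add: supp_def)
  hence "\<gamma> (supp d h) > 0" using assms by blast
  moreover have "(\<Prod>j\<in>supp d h. \<bar>real_of_int (h j)\<bar> powr \<alpha>) powr (- (1 / lam))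
      = (\<Prod>j\<in>supp d h. (\<bar>real_of_int (h j)\<bar> powr \<alpha>) powr (- (1 / lam)))"
    by (rule prod_powr_distrib)
  ultimately show ?thesis
    by (simp add: r_weight_def powr_mult prod_nonneg powr_powr powr_minus flip: inverse_powr)
qed

lemma supp_extend: "u \<subseteq> {1..d} \<Longrightarrow> g \<in> PiE u (\<lambda>_. nz_box H) \<Longrightarrow> supp d (\<lambda>i. if i \<in> u then g i else 0) = u"
  by (auto simp: supp_def nz_box_def PiE_def Pi_def)

text \<open>Writing membership in the dual lattice as an indicator makes the range of
  \<open>h\<close> independent of \<open>z\<close>, so that the two summations can be
  interchanged.\<close>

lemma dual_sum_finite_le:
  assumes \<gamma>: "\<forall>u. finite u \<longrightarrow> 0 < \<gamma> u" and lam: "0 < lam" "lam < \<alpha>" and p: "prime p"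
    and F: "finite F" "F \<subseteq> Zd_nz d"
  shows "(\<Sum>h\<in>F. \<Sum>z\<in>PiE {1..d} (\<lambda>_. {1..p - 1}).
            if int p dvd (\<Sum>i\<in>{1..d}. h i * int (z i)) then r_weight d \<alpha> \<gamma> h powr (- (1 / lam)) else 0)
     \<le> V_d d (\<alpha> / lam) (\<lambda>u. \<gamma> u powr (1 / lam)) * real ((p - 1) ^ (d - 1))"
proof -
  let ?s = "\<alpha> / lam" and ?Z = "PiE {1..d} (\<lambda>_. {1..p - 1})"
  have s: "?s > 1" using lam by simp
  have "(\<Sum>h\<in>F. \<Sum>z\<in>?Z.
            if int p dvd (\<Sum>i\<in>{1..d}. h i * int (z i)) then r_weight d \<alpha> \<gamma> h powr (- (1 / lam)) else 0)
     \<le> (\<Sum>u\<in>{u. u \<subseteq> {1..d} \<and> u \<noteq> {}}. \<gamma> u powr (1 / lam) * ((2 * zeta_r ?s) ^ card u * real ((p - 1) ^ (d - 1))))"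
  proof (rule sum_Zd_le_by_support[OF _ _ F])
    fix u H assume u: "u \<subseteq> {1..d}" "u \<noteq> {}"
    have "(\<Sum>g\<in>PiE u (\<lambda>_. nz_box H). \<Sum>z\<in>?Z.
        if int p dvd (\<Sum>i\<in>{1..d}. (if i \<in> u then g i else 0) * int (z i))
        then r_weight d \<alpha> \<gamma> (\<lambda>i. if i \<in> u then g i else 0) powr (- (1 / lam)) else 0)
      = (\<Sum>g\<in>PiE u (\<lambda>_. nz_box H). \<Sum>z\<in>?Z. \<gamma> u powr (1 / lam) *
        (if int p dvd (\<Sum>i\<in>u. g i * int (z i)) then \<Prod>i\<in>u. \<bar>real_of_int (g i)\<bar> powr (- ?s) else 0))"
    proof (intro sum.cong refl)
      fix g z assume g: "g \<in> PiE u (\<lambda>_. nz_box H)"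
      have "(\<Sum>i\<in>{1..d}. (if i \<in> u then g i else 0) * int (z i)) = (\<Sum>i\<in>u. g i * int (z i))"
        using u by (intro sum.mono_neutral_cong_right) auto
      thus "(if int p dvd (\<Sum>i\<in>{1..d}. (if i \<in> u then g i else 0) * int (z i))
        then r_weight d \<alpha> \<gamma> (\<lambda>i. if i \<in> u then g i else 0) powr (- (1 / lam)) else 0)
        = \<gamma> u powr (1 / lam) *
        (if int p dvd (\<Sum>i\<in>u. g i * int (z i)) then \<Prod>i\<in>u. \<bar>real_of_int (g i)\<bar> powr (- ?s) else 0)"
        unfolding r_weight_powr[OF \<gamma>] supp_extend[OF u(1) g] by auto
    qed
    also have "\<dots> = \<gamma> u powr (1 / lam) * (\<Sum>g\<in>PiE u (\<lambda>_. nz_box H). \<Sum>z\<in>?Z.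
        (if int p dvd (\<Sum>i\<in>u. g i * int (z i)) then \<Prod>i\<in>u. \<bar>real_of_int (g i)\<bar> powr (- ?s) else 0))"
      by (simp only: sum_distrib_left)
    also have "\<dots> \<le> \<gamma> u powr (1 / lam) * ((2 * zeta_r ?s) ^ card u * real ((p - 1) ^ (d - 1)))"
      using sum_frequencies_generators_le[OF p s, of "{1..d}" u H] u by (intro mult_left_mono) auto
    finally show "(\<Sum>g\<in>PiE u (\<lambda>_. nz_box H). \<Sum>z\<in>?Z.
        if int p dvd (\<Sum>i\<in>{1..d}. (if i \<in> u then g i else 0) * int (z i))
        then r_weight d \<alpha> \<gamma> (\<lambda>i. if i \<in> u then g i else 0) powr (- (1 / lam)) else 0)
      \<le> \<gamma> u powr (1 / lam) * ((2 * zeta_r ?s) ^ card u * real ((p - 1) ^ (d - 1)))" .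
  qed (auto intro!: sum_nonneg)
  thus ?thesis by (simp only: V_d_def sum_distrib_right mult.assoc)
qed

lemma r_weight_powr_summable:
  assumes \<gamma>: "\<forall>u. finite u \<longrightarrow> 0 < \<gamma> u" and lam: "0 < lam" "lam < \<alpha>"
  shows "(\<lambda>h. r_weight d \<alpha> \<gamma> h powr (- (1 / lam))) summable_on Zd_nz d"
proof (rule nonneg_bdd_above_summable_on)
  let ?s = "\<alpha> / lam"
  have s: "?s > 1" using lam by simp
  have "(\<Sum>h\<in>F. r_weight d \<alpha> \<gamma> h powr (- (1 / lam)))
    \<le> (\<Sum>u\<in>{u. u \<subseteq> {1..d} \<and> u \<noteq> {}}. \<gamma> u powr (1 / lam) * (2 * zeta_r ?s) ^ card u)"
    if F: "finite F" "F \<subseteq> Zd_nz d" for F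
  proof (rule sum_Zd_le_by_support[OF _ _ F])
    fix u H assume u: "u \<subseteq> {1..d}" "u \<noteq> {}"
    have "(\<Sum>g\<in>PiE u (\<lambda>_. nz_box H). r_weight d \<alpha> \<gamma> (\<lambda>i. if i \<in> u then g i else 0) powr (- (1 / lam)))
      = (\<Sum>g\<in>PiE u (\<lambda>_. nz_box H). \<gamma> u powr (1 / lam) * (\<Prod>i\<in>u. \<bar>real_of_int (g i)\<bar> powr (- ?s)))"
    proof (intro sum.cong refl)
      fix g assume g: "g \<in> PiE u (\<lambda>_. nz_box H)"
      show "r_weight d \<alpha> \<gamma> (\<lambda>i. if i \<in> u then g i else 0) powr (- (1 / lam))
        = \<gamma> u powr (1 / lam) * (\<Prod>i\<in>u. \<bar>real_of_int (g i)\<bar> powr (- ?s))"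
        unfolding r_weight_powr[OF \<gamma>] supp_extend[OF u(1) g] by auto
    qed
    also have "\<dots> = \<gamma> u powr (1 / lam) * (\<Prod>i\<in>u. \<Sum>a\<in>nz_box H. \<bar>real_of_int a\<bar> powr (- ?s))"
      using u by (subst prod_sum_PiE) (auto simp: sum_distrib_left intro: finite_subset)
    also have "\<dots> \<le> \<gamma> u powr (1 / lam) * (\<Prod>i\<in>u. 2 * zeta_r ?s)"
      by (intro mult_left_mono prod_mono conjI sum_nz_box_powr_le s sum_nonneg) auto
    finally show "(\<Sum>g\<in>PiE u (\<lambda>_. nz_box H). r_weight d \<alpha> \<gamma> (\<lambda>i. if i \<in> u then g i else 0) powr (- (1 / lam)))
      \<le> \<gamma> u powr (1 / lam) * (2 * zeta_r ?s) ^ card u" by simp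
  qed auto
  thus "bdd_above (sum (\<lambda>h. r_weight d \<alpha> \<gamma> h powr (- (1 / lam))) ` {F. F \<subseteq> Zd_nz d \<and> finite F})"
    by (intro bdd_aboveI) blast
qed auto

text \<open>The dual lattice of the rule without the origin.\<close>

definition dual_nz :: "nat \<Rightarrow> nat \<Rightarrow> (nat \<Rightarrow> nat) \<Rightarrow> (nat \<Rightarrow> int) set" where
  "dual_nz d p z = {h \<in> Zd_nz d. int p dvd (\<Sum>i\<in>{1..d}. h i * int (z i))}"

text \<open>At \<open>lam = 1 / 2\<close> the exponent is -2, so this one family contains both the
  sum that bounds the squared error and the sums whose means are estimated.\<close>

definition dual_sum :: "nat \<Rightarrow> real \<Rightarrow> (nat set \<Rightarrow> real) \<Rightarrow> real \<Rightarrow> nat \<Rightarrow> (nat \<Rightarrow> nat) \<Rightarrow> real" where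
  "dual_sum d \<alpha> \<gamma> lam p z = (\<Sum>\<^sub>\<infinity>h\<in>dual_nz d p z. r_weight d \<alpha> \<gamma> h powr (- (1 / lam)))"

lemma dual_summable:
  assumes "\<forall>u. finite u \<longrightarrow> 0 < \<gamma> u" "0 < lam" "lam < \<alpha>"
  shows "(\<lambda>h. r_weight d \<alpha> \<gamma> h powr (- (1 / lam))) summable_on dual_nz d p z"
  by (rule summable_on_subset_banach[OF r_weight_powr_summable[OF assms]]) (auto simp: dual_nz_def)

lemma has_sum_finite_sum:
  fixes f :: "'a \<Rightarrow> 'b \<Rightarrow> 'c::topological_comm_monoid_add"
  assumes "finite I" "\<And>i. i \<in> I \<Longrightarrow> (f i has_sum S i) A"
  shows "((\<lambda>x. \<Sum>i\<in>I. f i x) has_sum (\<Sum>i\<in>I. S i)) A"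
  using assms by (induction I rule: finite_induct) (auto intro!: has_sum_add)

text \<open>For \<open>d \<ge> 1\<close>, dividing by the number \<open>(p - 1) ^ d\<close> of
  generators gives the mean bound V/(p - 1).\<close>

lemma sum_dual_sum_le:
  assumes \<gamma>: "\<forall>u. finite u \<longrightarrow> 0 < \<gamma> u" and lam: "0 < lam" "lam < \<alpha>" and p: "prime p"
  shows "(\<Sum>z\<in>PiE {1..d} (\<lambda>_. {1..p - 1}). dual_sum d \<alpha> \<gamma> lam p z)
     \<le> V_d d (\<alpha> / lam) (\<lambda>u. \<gamma> u powr (1 / lam)) * real ((p - 1) ^ (d - 1))"
proof -
  let ?Z = "PiE {1..d} (\<lambda>_. {1..p - 1})"
  let ?f = "\<lambda>z h. if int p dvd (\<Sum>i\<in>{1..d}. h i * int (z i)) then r_weight d \<alpha> \<gamma> h powr (- (1 / lam)) else 0"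
  have "(?f z has_sum dual_sum d \<alpha> \<gamma> lam p z) (Zd_nz d)" for z
  proof -
    have "((\<lambda>h. r_weight d \<alpha> \<gamma> h powr (- (1 / lam))) has_sum dual_sum d \<alpha> \<gamma> lam p z) (dual_nz d p z)"
      unfolding dual_sum_def by (intro has_sum_infsum dual_summable \<gamma> lam)
    thus ?thesis by (rule has_sum_cong_neutral[THEN iffD1, rotated -1]) (auto simp: dual_nz_def)
  qed
  hence *: "((\<lambda>h. \<Sum>z\<in>?Z. ?f z h) has_sum (\<Sum>z\<in>?Z. dual_sum d \<alpha> \<gamma> lam p z)) (Zd_nz d)"
    by (intro has_sum_finite_sum) (auto intro!: finite_PiE)
  show ?thesis
    by (rule has_sum_le_finite_sums[OF *]) (rule dual_sum_finite_le[OF \<gamma> lam p])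
qed

text \<open>This is Jensen's inequality for sums, sum x \<le> (sum x^t)^(1/t), with x the inverse
  square of the weight and t = 1/(2 lam). The hypothesis \<open>1 / 2 \<le> lam\<close> is what
  makes t at most 1.\<close>

lemma sqrt_dual_sum_le:
  assumes \<gamma>: "\<forall>u. finite u \<longrightarrow> 0 < \<gamma> u" and lam: "1 / 2 \<le> lam" "lam < \<alpha>"
  shows "sqrt (dual_sum d \<alpha> \<gamma> (1 / 2) p z) \<le> dual_sum d \<alpha> \<gamma> lam p z powr lam"
proof -
  define A where "A = dual_sum d \<alpha> \<gamma> (1 / 2) p z"
  define B where "B = dual_sum d \<alpha> \<gamma> lam p z"
  let ?r = "\<lambda>h. r_weight d \<alpha> \<gamma> h"
  let ?L = "dual_nz d p z"
  have A0: "A \<ge> 0" unfolding A_def dual_sum_def by (intro infsum_nonneg) auto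
  have sA: "((\<lambda>h. ?r h powr (- (1 / (1 / 2)))) has_sum A) ?L"
    unfolding A_def dual_sum_def using lam by (intro has_sum_infsum dual_summable \<gamma>) auto
  have sB: "((\<lambda>h. ?r h powr (- (1 / lam))) has_sum B) ?L"
    unfolding B_def dual_sum_def using lam by (intro has_sum_infsum dual_summable \<gamma>) auto
  show ?thesis
  proof (cases "A = 0")
    case True
    thus ?thesis by (simp flip: A_def)
  next
    case False
    with A0 have A: "A > 0" by simp
    let ?t = "1 / (2 * lam)"
    have t: "0 < ?t" "?t \<le> 1" using lam by (auto simp: field_simps)
    \<comment> \<open>Each term \<open>x\<close> of \<open>A\<close> satisfies \<open>x \<le> A\<close>, so \<open>(x / A) powr t \<ge> x / A\<close>.\<close>
    have term_le: "?r h powr (- (1 / (1 / 2))) * A powr (?t - 1) \<le> ?r h powr (- (1 / lam))" if h: "h \<in> ?L" for h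
    proof -
      define x where "x = ?r h powr (- (1 / (1 / 2)))"
      have x: "x > 0" unfolding x_def using r_weight_pos[OF \<gamma>, of d \<alpha> h] by simp
      have "sum (\<lambda>h. ?r h powr (- (1 / (1 / 2)))) {h} \<le> A"
        using h by (intro finite_sum_le_has_sum[OF sA]) auto
      hence xA: "x \<le> A" by (simp add: x_def)
      have "x * A powr (?t - 1) \<le> x * x powr (?t - 1)"
        using x xA t by (intro mult_left_mono powr_mono2') auto
      also have "\<dots> = x powr ?t" using x by (simp add: powr_diff)
      also have "\<dots> = ?r h powr (- (1 / lam))" unfolding x_def by (simp add: powr_powr)
      finally show ?thesis by (simp only: x_def)
    qed
    have "A * A powr (?t - 1) \<le> B"
      by (rule has_sum_mono[OF has_sum_cmult_left[OF sA] sB term_le])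
    hence "A powr ?t \<le> B" using A by (simp add: powr_diff)
    hence "(A powr ?t) powr lam \<le> B powr lam" using lam by (intro powr_mono2) auto
    moreover have "(A powr ?t) powr lam = sqrt A" using lam A by (simp add: powr_powr powr_half_sqrt)
    ultimately show ?thesis by (simp add: A_def B_def)
  qed
qed

section \<open>Error of lattice rules and of their median\<close>

lemma sum_roots_of_unity:
  fixes m :: int
  assumes "p > 0"
  shows "(\<Sum>k<p. cis (2 * pi * real k * real_of_int m / real p)) = (if int p dvd m then of_nat p else 0)"
proof -
  define w where "w = cis (2 * pi * real_of_int m / real p)"
  have pow: "cis (2 * pi * real k * real_of_int m / real p) = w ^ k" for k
    unfolding w_def Complex.DeMoivre by (rule arg_cong[of _ _ cis]) simp
  have w1: "w = 1 \<longleftrightarrow> int p dvd m"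
  proof
    assume "w = 1"
    then obtain t :: int where "2 * pi * real_of_int m / real p = of_int t * (2 * pi)"
      unfolding w_def cis_eq_1_iff by blast
    hence "real_of_int m = real_of_int (int p * t)" using assms by (simp add: field_simps)
    thus "int p dvd m" by (metis dvd_triv_left of_int_eq_iff)
  next
    assume "int p dvd m"
    then obtain t where "m = int p * t" by blast
    thus "w = 1" unfolding w_def cis_eq_1_iff using assms by (intro exI[of _ t]) simp
  qed
  show ?thesis
  proof (cases "w = 1")
    case True
    thus ?thesis using w1 by (simp add: pow)
  next
    case False
    have "w ^ p = cis (2 * pi * real_of_int m)" using assms by (simp add: w_def Complex.DeMoivre)
    also have "\<dots> = 1" unfolding cis_eq_1_iff by (intro exI[of _ m]) simp
    finally show ?thesis using False w1 by (simp add: pow geometric_sum)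
  qed
qed

text \<open>Taking fractional parts changes the inner product with \<open>h\<close> by an integer
  \<open>t\<close>, which the exponential does not see.\<close>

lemma expo_lattice_point:
  assumes "p > 0"
  shows "expo d h (restrict (\<lambda>j. frac (real k * real (z j) / real p)) {1..d})
    = cis (2 * pi * real k * real_of_int (\<Sum>i\<in>{1..d}. h i * int (z i)) / real p)"
proof -
  define t :: int where "t = (\<Sum>i\<in>{1..d}. h i * \<lfloor>real k * real (z i) / real p\<rfloor>)"
  have "dotp d h (restrict (\<lambda>j. frac (real k * real (z j) / real p)) {1..d})
     = (\<Sum>i\<in>{1..d}. real_of_int (h i) * (real k * real (z i) / real p)
          - real_of_int (h i * \<lfloor>real k * real (z i) / real p\<rfloor>))"
    unfolding dotp_def by (intro sum.cong refl) (simp add: frac_def algebra_simps)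
  also have "\<dots> = real k * real_of_int (\<Sum>i\<in>{1..d}. h i * int (z i)) / real p - real_of_int t"
    by (simp add: sum_subtractf t_def sum_distrib_left sum_divide_distrib mult_ac)
  finally have eq: "dotp d h (restrict (\<lambda>j. frac (real k * real (z j) / real p)) {1..d})
     = real k * real_of_int (\<Sum>i\<in>{1..d}. h i * int (z i)) / real p - real_of_int t" .
  have "expo d h (restrict (\<lambda>j. frac (real k * real (z j) / real p)) {1..d})
     = cis (2 * pi * real k * real_of_int (\<Sum>i\<in>{1..d}. h i * int (z i)) / real p - of_int t * (2 * pi))"
    unfolding expo_def eq by (rule arg_cong[of _ _ cis]) (simp add: right_diff_distrib mult_ac)
  also have "\<dots> = cis (2 * pi * real k * real_of_int (\<Sum>i\<in>{1..d}. h i * int (z i)) / real p) / cis (of_int t * (2 * pi))"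
    by (simp add: cis_divide)
  also have "cis (of_int t * (2 * pi)) = 1" unfolding cis_eq_1_iff by blast
  finally show ?thesis unfolding div_by_1 .
qed

text \<open>Averaging the Fourier series over the nodes keeps exactly the coefficients on the dual
  lattice, and the coefficient at the origin is the integral.\<close>

lemma lattice_rule_has_sum:
  assumes f: "korobov d \<alpha> \<gamma> f" and p: "p > 0"
  shows "(fcoeff d f has_sum (lattice_rule d p z f - Int_d d f)) (dual_nz d p z)"
proof -
  let ?x = "\<lambda>k. restrict (\<lambda>j. frac (real k * real (z j) / real p)) {1..d}"
  let ?m = "\<lambda>h. \<Sum>i\<in>{1..d}. h i * int (z i)"
  let ?L = "{h \<in> Zd d. int p dvd ?m h}"
  \<comment> \<open>The Fourier series is known to represent \<open>f\<close> only on the cube, so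
    every node has to lie there.\<close>
  have cube: "?x k \<in> cube d" for k
    by (auto simp: cube_def frac_lt_1 less_imp_le)
  have "((\<lambda>h. \<Sum>k<p. fcoeff d f h * expo d h (?x k)) has_sum (\<Sum>k<p. f (?x k))) (Zd d)"
    using f cube by (intro has_sum_finite_sum) (auto simp: korobov_def)
  hence "((\<lambda>h. (\<Sum>k<p. fcoeff d f h * expo d h (?x k)) * (1 / of_nat p)) has_sum
      ((\<Sum>k<p. f (?x k)) * (1 / of_nat p))) (Zd d)"
    by (rule has_sum_cmult_left)
  moreover have "(\<Sum>k<p. fcoeff d f h * expo d h (?x k)) * (1 / of_nat p)
      = (if int p dvd ?m h then fcoeff d f h else 0)" for h
    unfolding expo_lattice_point[OF p] sum_distrib_left[symmetric] sum_roots_of_unity[OF p]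
    using p by simp
  ultimately have "((\<lambda>h. if int p dvd ?m h then fcoeff d f h else 0) has_sum lattice_rule d p z f) (Zd d)"
    by (simp add: lattice_rule_def)
  hence "(fcoeff d f has_sum lattice_rule d p z f) ?L"
    by (rule has_sum_cong_neutral[THEN iffD1, rotated -1]) auto
  moreover have "(fcoeff d f has_sum fcoeff d f (\<lambda>_. 0)) {\<lambda>_. 0}"
    by (rule has_sum_finiteI) auto
  ultimately have "(fcoeff d f has_sum (lattice_rule d p z f - fcoeff d f (\<lambda>_. 0))) (?L - {\<lambda>_. 0})"
    by (rule has_sum_Diff) (auto simp: Zd_def)
  moreover have "fcoeff d f (\<lambda>_. 0) = Int_d d f"
    by (simp add: fcoeff_def Int_d_def expo_def dotp_def)
  moreover have "?L - {\<lambda>_. 0} = dual_nz d p z" by (auto simp: dual_nz_def)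
  ultimately show ?thesis by simp
qed

text \<open>Cauchy-Schwarz after multiplying and dividing each coefficient by its weight; it is
  applied to finite partial sums and then carried over to the infinite sum.\<close>

lemma lattice_rule_error:
  assumes \<gamma>: "\<forall>u. finite u \<longrightarrow> 0 < \<gamma> u" and \<alpha>: "\<alpha> > 1 / 2" and p: "p > 0"
    and f: "korobov d \<alpha> \<gamma> f" "kor_norm_sq d \<alpha> \<gamma> f \<le> 1"
  shows "cmod (Int_d d f - lattice_rule d p z f) \<le> sqrt (dual_sum d \<alpha> \<gamma> (1 / 2) p z)"
proof -
  let ?L = "dual_nz d p z" and ?r = "r_weight d \<alpha> \<gamma>" and ?c = "\<lambda>h. cmod (fcoeff d f h)"
  have LZ: "?L \<subseteq> Zd d" by (auto simp: dual_nz_def)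
  have abs: "?c summable_on ?L"
    using f(1) LZ by (auto simp: korobov_def intro: summable_on_subset_banach)
  have "cmod (lattice_rule d p z f - Int_d d f) \<le> infsum ?c ?L"
    by (rule norm_infsum_le[OF lattice_rule_has_sum[OF f(1) p] has_sum_infsum[OF abs]]) simp
  also have "\<dots> \<le> sqrt (dual_sum d \<alpha> \<gamma> (1 / 2) p z)"
  proof (rule infsum_le_finite_sums[OF abs])
    fix F assume F: "finite F" "F \<subseteq> ?L"
    have rpos: "?r h > 0" for h by (rule r_weight_pos[OF \<gamma>])
    have "sum ?c F = (\<Sum>h\<in>F. (?r h * ?c h) * inverse (?r h))"
      using rpos by (intro sum.cong refl) (simp add: field_simps less_imp_neq[symmetric])
    hence "(sum ?c F)\<^sup>2 \<le> (\<Sum>h\<in>F. (?r h * ?c h)\<^sup>2) * (\<Sum>h\<in>F. (inverse (?r h))\<^sup>2)"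
      by (simp only: Cauchy_Schwarz_ineq_sum)
    also have "\<dots> \<le> 1 * dual_sum d \<alpha> \<gamma> (1 / 2) p z"
    proof (intro mult_mono)
      have "(\<Sum>h\<in>F. (?r h * ?c h)\<^sup>2) = (\<Sum>h\<in>F. (?r h)\<^sup>2 * (?c h)\<^sup>2)" by (simp add: power_mult_distrib)
      also have "\<dots> \<le> kor_norm_sq d \<alpha> \<gamma> f" unfolding kor_norm_sq_def
        using f(1) F LZ by (intro finite_sum_le_infsum) (auto simp: korobov_def)
      finally show "(\<Sum>h\<in>F. (?r h * ?c h)\<^sup>2) \<le> 1" using f(2) by simp
      have "(\<Sum>h\<in>F. (inverse (?r h))\<^sup>2) = (\<Sum>h\<in>F. ?r h powr (- (1 / (1 / 2))))"
        using rpos by (intro sum.cong refl) (simp add: powr_minus power_inverse less_imp_le)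
      also have "\<dots> \<le> dual_sum d \<alpha> \<gamma> (1 / 2) p z" unfolding dual_sum_def
        using F \<alpha> by (intro finite_sum_le_infsum dual_summable \<gamma>) auto
      finally show "(\<Sum>h\<in>F. (inverse (?r h))\<^sup>2) \<le> dual_sum d \<alpha> \<gamma> (1 / 2) p z" .
    qed (auto intro!: sum_nonneg)
    finally show "sum ?c F \<le> sqrt (dual_sum d \<alpha> \<gamma> (1 / 2) p z)" by (simp add: real_le_rsqrt)
  qed
  finally show ?thesis by (simp add: norm_minus_commute)
qed

section \<open>Medians\<close>

text \<open>Sorting does not change the number of outliers. A median below \<open>a\<close> would
  make the \<open>m + 1\<close> sorted positions up to the middle outliers, and a median above
  \<open>b\<close> those from the middle on.\<close>

lemma median_r_bounds:
  assumes len: "length xs = 2 * m + 1"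
    and bad: "card {i. i < 2 * m + 1 \<and> \<not> (a \<le> xs ! i \<and> xs ! i \<le> b)} \<le> m"
  shows "a \<le> median_r xs" "median_r xs \<le> b"
proof -
  let ?ys = "sort xs" and ?Q = "\<lambda>x. \<not> (a \<le> x \<and> x \<le> b)"
  have len': "length ?ys = 2 * m + 1" using len by simp
  have "length (filter ?Q ?ys) = length (filter ?Q xs)"
    by (simp add: filter_sort del: de_Morgan_conj)
  hence bad': "card {i. i < 2 * m + 1 \<and> ?Q (?ys ! i)} \<le> m"
    using bad by (simp only: length_filter_conv_card len len')
  have med: "median_r xs = ?ys ! m" using len by (simp add: median_r_def)
  have False if sub: "I \<subseteq> {i. i < 2 * m + 1 \<and> ?Q (?ys ! i)}" and card: "card I = m + 1" for I
  proof -
    have "m + 1 \<le> card {i. i < 2 * m + 1 \<and> ?Q (?ys ! i)}"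
      unfolding card[symmetric] by (intro card_mono sub) auto
    thus False using bad' by simp
  qed
  note contr = this
  show "a \<le> median_r xs"
  proof (rule ccontr)
    assume *: "\<not> ?thesis"
    have "?ys ! i \<le> ?ys ! m" if "i \<le> m" for i
      using that len' by (intro sorted_nth_mono) auto
    hence "{..m} \<subseteq> {i. i < 2 * m + 1 \<and> ?Q (?ys ! i)}" using * med by force
    from contr[OF this] show False by simp
  qed
  show "median_r xs \<le> b"
  proof (rule ccontr)
    assume *: "\<not> ?thesis"
    have "?ys ! m \<le> ?ys ! i" if "m \<le> i" "i < 2 * m + 1" for i
      using that len' by (intro sorted_nth_mono) auto
    hence "{m..<2 * m + 1} \<subseteq> {i. i < 2 * m + 1 \<and> ?Q (?ys ! i)}" using * med by force
    from contr[OF this] show False by simp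
  qed
qed

text \<open>Real and imaginary part are 1-Lipschitz, so a rule that is good in modulus is good for
  both medians. Two errors of at most \<open>B\<close> combine to \<open>sqrt 2 * B\<close>.\<close>

lemma median_rule_error:
  assumes N: "N = 2 * m + 1"
    and bad: "card {k \<in> {1..N}. \<not> cmod (I - lattice_rule d (fst (\<omega> k)) (snd (\<omega> k)) f) \<le> B} \<le> m"
  shows "cmod (I - median_rule d N \<omega> f) \<le> sqrt 2 * B"
proof -
  let ?q = "\<lambda>k. lattice_rule d (fst (\<omega> k)) (snd (\<omega> k)) f"
  let ?X = "{k \<in> {1..N}. \<not> cmod (I - ?q k) \<le> B}"
  have proj: "\<bar>F I - median_r (map F (map ?q [1..<N + 1]))\<bar> \<le> B"
    if F: "\<And>z. \<bar>F I - F z\<bar> \<le> cmod (I - z)" for F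
  proof -
    let ?xs = "map F (map ?q [1..<N + 1])"
    let ?Y = "{i. i < 2 * m + 1 \<and> \<not> (F I - B \<le> ?xs ! i \<and> ?xs ! i \<le> F I + B)}"
    \<comment> \<open>List positions start at 0 and the rules at 1.\<close>
    have "?Y \<subseteq> (\<lambda>k. k - 1) ` ?X"
    proof
      fix i assume i: "i \<in> ?Y"
      hence nth: "?xs ! i = F (?q (Suc i))" using N by (simp del: upt_Suc)
      from i have "\<not> (F I - B \<le> ?xs ! i \<and> ?xs ! i \<le> F I + B)" by blast
      hence "\<not> cmod (I - ?q (Suc i)) \<le> B"
        using F[of "?q (Suc i)"] unfolding nth by (auto simp: abs_le_iff)
      hence "Suc i \<in> ?X" using i N by auto
      thus "i \<in> (\<lambda>k. k - 1) ` ?X" by force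
    qed
    hence "card ?Y \<le> card ((\<lambda>k. k - 1) ` ?X)" by (intro card_mono) auto
    also have "\<dots> \<le> card ?X" by (intro card_image_le) auto
    finally have "card ?Y \<le> m" using bad by simp
    thus ?thesis using median_r_bounds[of ?xs m "F I - B" "F I + B"] N by (auto simp: abs_le_iff)
  qed
  define D where "D = I - median_rule d N \<omega> f"
  have Re: "\<bar>Re D\<bar> \<le> B" using proj[of Re] abs_Re_le_cmod[of "I - _"]
    by (simp add: D_def median_rule_def median_c_def)
  have Im: "\<bar>Im D\<bar> \<le> B" using proj[of Im] abs_Im_le_cmod[of "I - _"]
    by (simp add: D_def median_rule_def median_c_def)
  have B: "B \<ge> 0" using Re by linarith
  have "(cmod D)\<^sup>2 \<le> B\<^sup>2 + B\<^sup>2"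
    unfolding cmod_power2 using power_mono[OF Re, of 2] power_mono[OF Im, of 2] by simp
  also have "\<dots> = (sqrt 2 * B)\<^sup>2" by (simp add: power_mult_distrib)
  finally have "cmod D \<le> sqrt 2 * B" by (rule power2_le_imp_le) (use B in simp)
  thus ?thesis by (simp add: D_def)
qed

section \<open>Tail of the binomial distribution\<close>

text \<open>As b \<le> 1 - b and \<open>N \<le> 2 * j\<close>, moving the surplus powers of b to 1 -
  b only increases the term and leaves a power of b (1 - b), which is monotone on [0, 1/2].
  Comparing squares avoids the half-integer exponent.\<close>

lemma binomial_term_le:
  fixes b c :: real
  assumes b: "0 \<le> b" "b \<le> c" "c \<le> 1 / 2" and c: "c > 0" and j: "j \<le> N" "N \<le> 2 * j"
  shows "b ^ j * (1 - b) ^ (N - j) \<le> (c * (1 - c)) powr (real N / 2)"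
proof -
  have c1: "c * (1 - c) > 0" using c b by simp
  have "(b ^ j * (1 - b) ^ (N - j))\<^sup>2 = b ^ (2 * j) * (1 - b) ^ (2 * (N - j))"
    by (simp add: power_mult_distrib power_mult[symmetric] mult.commute)
  also have "\<dots> = b ^ N * b ^ (2 * j - N) * (1 - b) ^ (2 * (N - j))"
    using j by (simp flip: power_add)
  also have "\<dots> \<le> b ^ N * (1 - b) ^ (2 * j - N) * (1 - b) ^ (2 * (N - j))"
    using b by (intro mult_right_mono mult_left_mono power_mono) auto
  also have "\<dots> = b ^ N * (1 - b) ^ ((2 * j - N) + 2 * (N - j))"
    by (simp only: power_add mult.assoc)
  also have "(2 * j - N) + 2 * (N - j) = N" using j by simp
  also have "b ^ N * (1 - b) ^ N = (b * (1 - b)) ^ N" by (simp add: power_mult_distrib)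
  also have "\<dots> \<le> (c * (1 - c)) ^ N"
  proof (intro power_mono)
    \<comment> \<open>The product equals c (1 - c) - b (1 - b).\<close>
    have "0 \<le> (c - b) * (1 - b - c)" using b by simp
    thus "b * (1 - b) \<le> c * (1 - c)" by (simp add: algebra_simps)
  qed (use b in auto)
  also have "\<dots> = ((c * (1 - c)) powr (real N / 2))\<^sup>2"
    using c1 by (simp add: power2_eq_square powr_realpow flip: powr_add)
  finally show ?thesis by (rule power2_le_imp_le) simp
qed

text \<open>The number of bad draws is binomially distributed. Every term of the upper tail has the
  same bound, and for odd \<open>N\<close> the tail coefficients add up to half of
  \<open>2 ^ N\<close>, which is the source of the factor 1/2.\<close>

lemma majority_tail:
  assumes b: "measure_pmf.prob q {x. bad x} \<le> c" and c: "0 < c" "c \<le> 1 / 2" and N: "N = 2 * m + 1"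
  shows "measure_pmf.prob (Pi_pmf {1..N} dflt (\<lambda>_. q)) {\<omega>. card {k \<in> {1..N}. bad (\<omega> k)} > m}
     \<le> 1 / 2 * (4 * c * (1 - c)) powr (real N / 2)"
proof -
  define b where "b = measure_pmf.prob q {x. bad x}"
  have b01: "b \<in> {0..1}" by (simp add: b_def)
  have ber: "map_pmf bad q = bernoulli_pmf b"
  proof (rule pmf_eqI)
    fix x :: bool
    have "pmf (map_pmf bad q) True = b" by (simp add: pmf_map b_def vimage_def)
    moreover have "pmf (map_pmf bad q) False = 1 - pmf (map_pmf bad q) True"
      by (rule pmf_False_conv_True)
    ultimately show "pmf (map_pmf bad q) x = pmf (bernoulli_pmf b) x" using b01 by (cases x) auto
  qed
  \<comment> \<open>Mapping \<open>bad\<close> over the product also maps its default value, hence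
    \<open>bad dflt\<close>.\<close>
  have "binomial_pmf N b = map_pmf (\<lambda>f. card {x\<in>{1..N}. f x}) (Pi_pmf {1..N} (bad dflt) (\<lambda>_. map_pmf bad q))"
    unfolding ber using b01 by (intro binomial_pmf_altdef') auto
  also have "\<dots> = map_pmf (\<lambda>\<omega>. card {k\<in>{1..N}. bad (\<omega> k)}) (Pi_pmf {1..N} dflt (\<lambda>_. q))"
    by (subst Pi_pmf_map[where dflt = dflt]) (auto simp: pmf.map_comp o_def)
  finally have "measure_pmf.prob (Pi_pmf {1..N} dflt (\<lambda>_. q)) {\<omega>. card {k \<in> {1..N}. bad (\<omega> k)} > m}
     = measure_pmf.prob (binomial_pmf N b) {j. j > m}"
    by (simp add: vimage_def)
  also have "\<dots> = measure_pmf.prob (binomial_pmf N b) {m<..N}"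
    using b01 by (intro measure_prob_cong_0) (auto simp: pmf_binomial)
  also have "\<dots> = (\<Sum>j\<in>{m<..N}. real (N choose j) * (b ^ j * (1 - b) ^ (N - j)))"
    using b01 by (subst measure_measure_pmf_finite) (auto simp: pmf_binomial mult_ac)
  also have "\<dots> \<le> (\<Sum>j\<in>{m<..N}. real (N choose j) * (c * (1 - c)) powr (real N / 2))"
    using b01 assms by (intro sum_mono mult_left_mono binomial_term_le) (auto simp: b_def)
  also have "\<dots> = real (\<Sum>j\<in>{m<..N}. N choose j) * (c * (1 - c)) powr (real N / 2)"
    by (simp add: sum_distrib_right)
  also have "(\<Sum>j\<in>{m<..N}. N choose j) = 2 ^ (2 * m)"
  proof -
    have "{..N} = {..m} \<union> {m<..N}" using N by auto
    hence "(\<Sum>j\<le>N. N choose j) = (\<Sum>j\<le>m. N choose j) + (\<Sum>j\<in>{m<..N}. N choose j)"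
      by (simp only:) (subst sum.union_disjoint, auto)
    thus ?thesis using binomial_r_part_sum[of m] choose_row_sum[of N] N by simp
  qed
  also have "real (2 ^ (2 * m)) * (c * (1 - c)) powr (real N / 2)
     = 1 / 2 * (4 * c * (1 - c)) powr (real N / 2)"
  proof -
    have "(4 :: real) powr (real N / 2) = (2 powr 2) powr (real N / 2)" by simp
    also have "\<dots> = 2 powr real N" unfolding powr_powr by simp
    also have "\<dots> = 2 ^ N" by (simp add: powr_realpow)
    also have "\<dots> = 2 * 2 ^ (2 * m)" using N by simp
    finally have "(4 :: real) powr (real N / 2) = 2 * 2 ^ (2 * m)" .
    thus ?thesis using c by (simp add: powr_mult mult.assoc)
  qed
  finally show ?thesis .
qed

section \<open>Sampling the rules\<close>

lemma primes_P_nonempty: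
  assumes "n \<ge> 2"
  shows "primes_P n \<noteq> {}"
proof (cases "even n")
  case True
  then obtain m where m: "n = 2 * m" by blast
  then obtain p where "prime p" "m < p" "p \<le> 2 * m" using Bertrand[of m] assms by auto
  hence "p \<in> primes_P n" using m by (simp add: primes_P_def)
  thus ?thesis by blast
next
  case False
  then obtain m where m: "n = 2 * m + 1" by (rule oddE)
  then obtain p where p: "prime p" "m + 1 < p" "p \<le> 2 * (m + 1)" using Bertrand[of "m + 1"] by auto
  \<comment> \<open>For odd \<open>n\<close> Bertrand's postulate at \<open>m + 1\<close> reaches
    one number beyond \<open>n\<close>, and that number is composite.\<close>
  have "p \<noteq> 2 * (m + 1)" using p(1) m assms prime_product[of 2 "m + 1"] by auto
  moreover have "\<lceil>real n / 2\<rceil> = int m + 1" using m by (intro ceiling_unique) auto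
  ultimately have "p \<in> primes_P n" using m p by (simp add: primes_P_def nat_add_distrib)
  thus ?thesis by blast
qed

lemma finite_primes_P: "finite (primes_P n)"
  by (rule finite_subset[of _ "{..n}"]) (auto simp: primes_P_def)

text \<open>The offset 1 in \<open>primes_P\<close> bounds \<open>p - 1\<close>, not just
  \<open>p\<close>, from below by n/2; this turns V/(p - 1) into 2V/n.\<close>

lemma primes_P_bound:
  assumes "p \<in> primes_P n"
  shows "prime p" "real n / 2 \<le> real (p - 1)"
proof -
  show "prime p" using assms by (simp add: primes_P_def)
  have "nat \<lceil>real n / 2\<rceil> + 1 \<le> p" using assms unfolding primes_P_def by blast
  thus "real n / 2 \<le> real (p - 1)" by linarith
qed

lemma V_d_pos:
  assumes \<gamma>: "\<forall>u. finite u \<longrightarrow> 0 < \<gamma> u" and d: "d \<ge> 1" and s: "s > 1"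
  shows "V_d d s (\<lambda>u. \<gamma> u powr t) > 0"
proof -
  have pos: "\<gamma> u powr t * (2 * zeta_r s) ^ card u > 0" if "u \<subseteq> {1..d}" for u
  proof -
    have "\<gamma> u > 0" using \<gamma> that by (meson finite_atLeastAtMost finite_subset)
    thus ?thesis using zeta_r_pos[OF s] by simp
  qed
  have "{1} \<in> {u. u \<subseteq> {1..d} \<and> u \<noteq> {}}" using d by auto
  thus ?thesis unfolding V_d_def by (intro sum_pos2[of _ "{1}"] pos) (simp_all add: less_imp_le[OF zeta_r_pos[OF s]])
qed

lemma set_pair_pmf:
  assumes "n \<ge> 2"
  shows "set_pmf (pair_pmf n d) = (\<Union>p\<in>primes_P n. Pair p ` PiE {1..d} (\<lambda>_. {1..p - 1}))"
    and "finite (set_pmf (pair_pmf n d))"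
proof -
  have ne: "PiE {1..d} (\<lambda>_. {1..p - 1}) \<noteq> {}" "finite (PiE {1..d} (\<lambda>_. {1..p - 1}))"
    if "p \<in> primes_P n" for p
    using primes_P_bound(1)[OF that] prime_ge_2_nat[of p] by (auto simp: PiE_eq_empty_iff intro!: finite_PiE)
  show eq: "set_pmf (pair_pmf n d) = (\<Union>p\<in>primes_P n. Pair p ` PiE {1..d} (\<lambda>_. {1..p - 1}))"
    unfolding pair_pmf_def using primes_P_nonempty[OF assms] finite_primes_P ne by (auto simp: set_pmf_of_set)
  show "finite (set_pmf (pair_pmf n d))"
    unfolding eq using finite_primes_P ne by auto
qed

text \<open>Markov's inequality for each fixed prime, then averaging over the prime. The threshold
  is the mean bound 2V/n divided by \<delta> and is the same for all primes.\<close>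

lemma prob_dual_sum_gt_le:
  assumes \<gamma>: "\<forall>u. finite u \<longrightarrow> 0 < \<gamma> u" and lam: "0 < lam" "lam < \<alpha>" and d: "d \<ge> 1" and n: "n \<ge> 2"
    and \<delta>: "\<delta> > 0"
  shows "measure_pmf.prob (pair_pmf n d)
      {\<omega>. dual_sum d \<alpha> \<gamma> lam (fst \<omega>) (snd \<omega>) > 2 / (\<delta> * real n) * V_d d (\<alpha> / lam) (\<lambda>u. \<gamma> u powr (1 / lam))}
     \<le> \<delta>"
proof -
  define V where "V = V_d d (\<alpha> / lam) (\<lambda>u. \<gamma> u powr (1 / lam))"
  define c where "c = 2 / (\<delta> * real n) * V"
  let ?X = "{\<omega>. dual_sum d \<alpha> \<gamma> lam (fst \<omega>) (snd \<omega>) > c}"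
  have V: "V > 0" unfolding V_def using lam by (intro V_d_pos \<gamma> d) auto
  have c: "c > 0" using V \<delta> n by (simp add: c_def)
  have inner: "measure_pmf.prob (map_pmf (Pair p) (pmf_of_set (PiE {1..d} (\<lambda>_. {1..p - 1})))) ?X \<le> \<delta>"
    if p: "p \<in> primes_P n" for p
  proof -
    let ?Z = "PiE {1..d} (\<lambda>_. {1..p - 1})"
    let ?Y = "{z. dual_sum d \<alpha> \<gamma> lam p z > c}"
    have pr: "prime p" and pn: "real n / 2 \<le> real (p - 1)" using primes_P_bound[OF p] by auto
    have p1: "real (p - 1) > 0" using prime_ge_2_nat[OF pr] by simp
    have Z: "?Z \<noteq> {}" "finite ?Z"
      using prime_ge_2_nat[OF pr] by (auto simp: PiE_eq_empty_iff intro!: finite_PiE)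
    have cZ: "card ?Z = (p - 1) ^ d" by (simp add: card_PiE)
    have nn: "dual_sum d \<alpha> \<gamma> lam p z \<ge> 0" for z unfolding dual_sum_def by (intro infsum_nonneg) auto
    have "real (card (?Z \<inter> ?Y)) * c = (\<Sum>z\<in>?Z \<inter> ?Y. c)" by simp
    also have "\<dots> \<le> (\<Sum>z\<in>?Z \<inter> ?Y. dual_sum d \<alpha> \<gamma> lam p z)" by (intro sum_mono) auto
    also have "\<dots> \<le> (\<Sum>z\<in>?Z. dual_sum d \<alpha> \<gamma> lam p z)" using Z nn by (intro sum_mono2) auto
    also have "\<dots> \<le> V * real ((p - 1) ^ (d - 1))"
      unfolding V_def by (rule sum_dual_sum_le[OF \<gamma> lam pr])
    finally have *: "real (card (?Z \<inter> ?Y)) * c \<le> V * real ((p - 1) ^ (d - 1))" .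
    have "V \<le> \<delta> * c * real (p - 1)"
    proof -
      have "V = \<delta> * c * (real n / 2)" using \<delta> n by (simp add: c_def)
      also have "\<dots> \<le> \<delta> * c * real (p - 1)" using pn \<delta> c by (intro mult_left_mono) auto
      finally show ?thesis .
    qed
    hence "V * real ((p - 1) ^ (d - 1)) \<le> \<delta> * c * real (p - 1) * real ((p - 1) ^ (d - 1))"
      by (intro mult_right_mono) auto
    also have "\<dots> = \<delta> * real (card ?Z) * c"
      using d unfolding cZ by (cases d) auto
    finally have "real (card (?Z \<inter> ?Y)) * c \<le> \<delta> * real (card ?Z) * c" using * by linarith
    hence "real (card (?Z \<inter> ?Y)) \<le> \<delta> * real (card ?Z)" using c by simp
    moreover have "card ?Z > 0" using Z by (simp add: card_gt_0_iff)
    ultimately have "real (card (?Z \<inter> ?Y)) / real (card ?Z) \<le> \<delta>" by (simp add: divide_le_eq)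
    thus ?thesis using Z by (simp add: measure_pmf_of_set vimage_def)
  qed
  have "emeasure (measure_pmf (pair_pmf n d)) ?X
     = (\<integral>\<^sup>+p. emeasure (map_pmf (Pair p) (pmf_of_set (PiE {1..d} (\<lambda>_. {1..p - 1})))) ?X \<partial>pmf_of_set (primes_P n))"
    unfolding pair_pmf_def map_pmf_def by (rule emeasure_bind_pmf)
  also have "\<dots> \<le> (\<integral>\<^sup>+p. ennreal \<delta> \<partial>pmf_of_set (primes_P n))"
  proof (rule nn_integral_mono_AE)
    show "AE p in measure_pmf (pmf_of_set (primes_P n)).
        emeasure (map_pmf (Pair p) (pmf_of_set (PiE {1..d} (\<lambda>_. {1..p - 1})))) ?X \<le> ennreal \<delta>"
      unfolding AE_measure_pmf_iff set_pmf_of_set[OF primes_P_nonempty[OF n] finite_primes_P]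
      using inner \<delta> by (auto simp only: measure_pmf.emeasure_eq_measure intro!: ennreal_leI)
  qed
  also have "\<dots> = ennreal \<delta>" by simp
  finally have "measure_pmf.prob (pair_pmf n d) ?X \<le> \<delta>"
    using \<delta> by (simp add: measure_pmf.emeasure_eq_measure)
  thus ?thesis by (simp add: c_def V_def)
qed

text \<open>The factor \<open>2 * sqrt 2\<close> is the constant \<open>4 * sqrt 2\<close> of the
  theorem divided by the constant 2 of the mean bound.\<close>

lemma sqrt2_powr_le:
  assumes "1 / 2 \<le> lam" "c \<ge> 0"
  shows "sqrt 2 * c powr lam \<le> (2 * sqrt 2 * c) powr lam"
proof -
  have "sqrt 2 = 2 powr (1 / 2)" by (simp add: powr_half_sqrt)
  also have "\<dots> \<le> 2 powr lam" using assms by (intro powr_mono) auto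
  also have "\<dots> \<le> (2 * sqrt 2) powr lam" using assms by (intro powr_mono2) auto
  finally have "sqrt 2 * c powr lam \<le> (2 * sqrt 2) powr lam * c powr lam" by (intro mult_right_mono) auto
  also have "\<dots> = (2 * sqrt 2 * c) powr lam" using assms by (simp add: powr_mult)
  finally show ?thesis .
qed

text \<open>A rule whose \<open>dual_sum\<close> stays within the Markov threshold meets the target
  bound, so the bad event lies inside the event of \<open>prob_dual_sum_gt_le\<close>.\<close>

lemma prob_bad_rule_le:
  assumes \<gamma>: "\<forall>u. finite u \<longrightarrow> 0 < \<gamma> u" and lam: "1 / 2 \<le> lam" "lam < \<alpha>" and d: "d \<ge> 1" and n: "n \<ge> 2"
    and \<delta>: "\<delta> > 0"
  shows "measure_pmf.prob (pair_pmf n d)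
      {\<omega>. sqrt 2 * sqrt (dual_sum d \<alpha> \<gamma> (1 / 2) (fst \<omega>) (snd \<omega>))
          > (4 * sqrt 2 / (\<delta> * real n) * V_d d (\<alpha> / lam) (\<lambda>u. \<gamma> u powr (1 / lam))) powr lam} \<le> \<delta>"
proof -
  define V where "V = V_d d (\<alpha> / lam) (\<lambda>u. \<gamma> u powr (1 / lam))"
  define c where "c = 2 / (\<delta> * real n) * V"
  have V: "V > 0" unfolding V_def using lam by (intro V_d_pos \<gamma> d) auto
  have c: "c > 0" using V \<delta> n by (simp add: c_def)
  have c4: "4 * sqrt 2 / (\<delta> * real n) * V = 2 * sqrt 2 * c" by (simp add: c_def)
  have "sqrt 2 * sqrt (dual_sum d \<alpha> \<gamma> (1 / 2) p z) \<le> (4 * sqrt 2 / (\<delta> * real n) * V) powr lam"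
    if "dual_sum d \<alpha> \<gamma> lam p z \<le> c" for p z
  proof -
    have "dual_sum d \<alpha> \<gamma> lam p z \<ge> 0" unfolding dual_sum_def by (intro infsum_nonneg) auto
    hence "dual_sum d \<alpha> \<gamma> lam p z powr lam \<le> c powr lam" using that lam by (intro powr_mono2) auto
    with sqrt_dual_sum_le[OF \<gamma> lam, of d p z]
    have "sqrt 2 * sqrt (dual_sum d \<alpha> \<gamma> (1 / 2) p z) \<le> sqrt 2 * c powr lam"
      by (intro mult_left_mono) auto
    also have "\<dots> \<le> (2 * sqrt 2 * c) powr lam" using c lam by (intro sqrt2_powr_le) auto
    finally show ?thesis unfolding c4 .
  qed
  hence "{\<omega>. sqrt 2 * sqrt (dual_sum d \<alpha> \<gamma> (1 / 2) (fst \<omega>) (snd \<omega>)) > (4 * sqrt 2 / (\<delta> * real n) * V) powr lam}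
     \<subseteq> {\<omega>. dual_sum d \<alpha> \<gamma> lam (fst \<omega>) (snd \<omega>) > c}"
    by (auto simp: not_le[symmetric] simp del: real_sqrt_mult)
  hence "measure_pmf.prob (pair_pmf n d) {\<omega>. sqrt 2 * sqrt (dual_sum d \<alpha> \<gamma> (1 / 2) (fst \<omega>) (snd \<omega>))
          > (4 * sqrt 2 / (\<delta> * real n) * V) powr lam}
     \<le> measure_pmf.prob (pair_pmf n d) {\<omega>. dual_sum d \<alpha> \<gamma> lam (fst \<omega>) (snd \<omega>) > c}"
    by (intro measure_pmf.finite_measure_mono) auto
  also have "\<dots> \<le> \<delta>" unfolding c_def V_def using lam by (intro prob_dual_sum_gt_le \<gamma> d n \<delta>) auto
  finally show ?thesis by (simp only: V_def)
qed

text \<open>No union bound over \<open>L\<close> is taken. Each bad \<open>x\<close> in the finite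
  support picks a witness \<open>l x\<close>; for the \<open>y\<close> with the smallest
  \<open>R (l y)\<close>, every bad \<open>x\<close> exceeds already \<open>R (l y)\<close>, so a
  single index covers the whole event.\<close>

lemma prob_exists_gt_le:
  fixes X :: "'a \<Rightarrow> real" and R :: "'b \<Rightarrow> real"
  assumes fin: "finite (set_pmf q)" and \<delta>: "\<delta> \<ge> 0"
    and le: "\<And>l. l \<in> L \<Longrightarrow> measure_pmf.prob q {x. X x > R l} \<le> \<delta>"
  shows "measure_pmf.prob q {x. \<exists>l\<in>L. X x > R l} \<le> \<delta>"
proof -
  let ?Y = "{x. \<exists>l\<in>L. X x > R l} \<inter> set_pmf q"
  have eq: "measure_pmf.prob q {x. \<exists>l\<in>L. X x > R l} = measure_pmf.prob q ?Y"
    by (simp add: measure_Int_set_pmf)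
  show ?thesis
  proof (cases "?Y = {}")
    case True
    thus ?thesis using \<delta> by (simp only: eq True measure_empty)
  next
    case False
    have "\<forall>x\<in>?Y. \<exists>l. l \<in> L \<and> X x > R l" by blast
    then obtain l where l: "\<And>x. x \<in> ?Y \<Longrightarrow> l x \<in> L \<and> X x > R (l x)" by metis
    have finY: "finite ?Y" using fin by blast
    obtain y where y: "y \<in> ?Y" "\<And>x. x \<in> ?Y \<Longrightarrow> R (l y) \<le> R (l x)"
      using ex_min_if_finite[of "(\<lambda>x. R (l x)) ` ?Y"] finY False by (auto simp: not_less)
    have "?Y \<subseteq> {x. X x > R (l y)}"
    proof
      fix x assume x: "x \<in> ?Y"
      show "x \<in> {x. X x > R (l y)}" using l[OF x] y(2)[OF x] by simp
    qed
    hence "measure_pmf.prob q ?Y \<le> measure_pmf.prob q {x. X x > R (l y)}"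
      by (intro measure_pmf.finite_measure_mono) auto
    also have "\<dots> \<le> \<delta>" using l[OF y(1)] by (intro le) auto
    finally show ?thesis by (simp only: eq)
  qed
qed

theorem mainTheorem6:
  fixes h :: "nat \<Rightarrow> real" and \<alpha> \<tau> :: real and \<gamma> :: "nat set \<Rightarrow> real" and d n :: nat
  assumes h_ge: "\<And>m. h m \<ge> 1"
    and h_lim: "filterlim h at_top sequentially"
    and \<alpha>: "\<alpha> > 1/2"
    and \<gamma>_pos: "\<And>u. finite u \<Longrightarrow> 0 < \<gamma> u \<and> \<gamma> u \<le> 1"
    and \<gamma>_empty: "\<gamma> {} = 1"
    and d: "d \<ge> 1"
    and n: "n \<ge> 2"
    and \<tau>: "1/2 < \<tau>" "\<tau> < 1"
  shows "measure_pmf.prob (sample_pmf (N_rep h n) n d)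
           {\<omega>. e_det d \<alpha> \<gamma> (median_rule d (N_rep h n) \<omega>)
                \<le> (INF lam\<in>{1/2..<\<alpha>}.
                     ereal ((4 * sqrt 2 / ((1 - \<tau>) * real n)
                             * V_d d (\<alpha> / lam) (\<lambda>u. \<gamma> u powr (1 / lam))) powr lam))}
         \<ge> 1 - (1/2) * (4 * \<tau> * (1 - \<tau>)) powr (real (N_rep h n) / 2)"
proof -
  have \<gamma>: "\<forall>u. finite u \<longrightarrow> 0 < \<gamma> u" using \<gamma>_pos by blast
  define N where "N = N_rep h n"
  define m where "m = nat \<lceil>h n * log 2 (real n)\<rceil>"
  \<comment> \<open>Nonnegativity makes \<open>nat\<close> harmless in \<open>N_rep\<close>, so that
    \<open>N\<close> is odd.\<close>
  have "h n * log 2 (real n) \<ge> 0" using h_ge[of n] n by simp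
  hence N: "N = 2 * m + 1" by (simp add: N_def N_rep_def m_def nat_add_distrib nat_mult_distrib)
  define R where "R = (\<lambda>lam. (4 * sqrt 2 / ((1 - \<tau>) * real n)
                             * V_d d (\<alpha> / lam) (\<lambda>u. \<gamma> u powr (1 / lam))) powr lam)"
  define X where "X = (\<lambda>\<omega>. sqrt 2 * sqrt (dual_sum d \<alpha> \<gamma> (1 / 2) (fst \<omega>) (snd \<omega>)))"
  \<comment> \<open>The error bound for lattice rules needs \<open>p > 0\<close>, hence the first disjunct; its probability is 0.\<close>
  define bad where "bad = (\<lambda>\<omega>. fst \<omega> = 0 \<or> (\<exists>lam\<in>{1/2..<\<alpha>}. X \<omega> > R lam))"
  have "measure_pmf.prob (pair_pmf n d) {\<omega>. bad \<omega>} = measure_pmf.prob (pair_pmf n d) {\<omega>. \<exists>lam\<in>{1/2..<\<alpha>}. X \<omega> > R lam}"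
  proof (rule measure_prob_cong_0)
    have "fst \<omega> \<noteq> 0" if "\<omega> \<in> set_pmf (pair_pmf n d)" for \<omega>
      using that primes_P_bound(1) prime_gt_0_nat unfolding set_pair_pmf(1)[OF n] by fastforce
    thus "pmf (pair_pmf n d) \<omega> = 0" if "\<omega> \<in> {\<omega>. bad \<omega>} - {\<omega>. \<exists>lam\<in>{1/2..<\<alpha>}. X \<omega> > R lam}" for \<omega>
      using that unfolding bad_def set_pmf_iff by blast
  qed (auto simp: bad_def)
  also have "\<dots> \<le> 1 - \<tau>"
    unfolding X_def R_def using \<tau> set_pair_pmf(2)[OF n]
    by (intro prob_exists_gt_le prob_bad_rule_le \<gamma> d n) auto
  finally have "measure_pmf.prob (sample_pmf N n d) {\<omega>. card {k \<in> {1..N}. bad (\<omega> k)} > m}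
      \<le> 1 / 2 * (4 * (1 - \<tau>) * (1 - (1 - \<tau>))) powr (real N / 2)"
    \<comment> \<open>The tail bound is used with \<open>c = 1 - \<tau>\<close>, which is below 1/2
      because \<open>\<tau> > 1/2\<close>.\<close>
    unfolding sample_pmf_def using \<tau> N by (intro majority_tail) auto
  hence tail: "measure_pmf.prob (sample_pmf N n d) {\<omega>. card {k \<in> {1..N}. bad (\<omega> k)} > m}
      \<le> 1 / 2 * (4 * \<tau> * (1 - \<tau>)) powr (real N / 2)" by (simp add: mult_ac)
  \<comment> \<open>The event \<open>bad\<close> does not mention \<open>f\<close> and covers all
    \<open>lam\<close> at once, so one favourable sample serves the supremum over \<open>f\<close>
    and the infimum over \<open>lam\<close> together.\<close>
  have good: "e_det d \<alpha> \<gamma> (median_rule d N \<omega>) \<le> (INF lam\<in>{1/2..<\<alpha>}. ereal (R lam))"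
    if \<omega>: "card {k \<in> {1..N}. bad (\<omega> k)} \<le> m" for \<omega>
    unfolding e_det_def
  proof (intro SUP_least INF_greatest)
    fix f lam assume f: "f \<in> {f. korobov d \<alpha> \<gamma> f \<and> kor_norm_sq d \<alpha> \<gamma> f \<le> 1}" and lam: "lam \<in> {1/2..<\<alpha>}"
    let ?err = "\<lambda>k. cmod (Int_d d f - lattice_rule d (fst (\<omega> k)) (snd (\<omega> k)) f)"
    \<comment> \<open>The division by \<open>sqrt 2\<close> cancels the loss in
      \<open>median_rule_error\<close>; \<open>X\<close> carries the same factor for this
      purpose.\<close>
    have "?err k \<le> R lam / sqrt 2" if k: "\<not> bad (\<omega> k)" for k
    proof -
      have "?err k \<le> sqrt (dual_sum d \<alpha> \<gamma> (1 / 2) (fst (\<omega> k)) (snd (\<omega> k)))"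
        using f k by (intro lattice_rule_error \<gamma> \<alpha>) (auto simp: bad_def)
      moreover have "X (\<omega> k) \<le> R lam" using k lam unfolding bad_def by force
      ultimately have "sqrt 2 * ?err k \<le> R lam" unfolding X_def
        by (meson mult_left_mono order_trans real_sqrt_ge_zero zero_le_numeral)
      thus ?thesis by (simp add: field_simps)
    qed
    hence "card {k \<in> {1..N}. \<not> ?err k \<le> R lam / sqrt 2} \<le> card {k \<in> {1..N}. bad (\<omega> k)}"
      by (intro card_mono) auto
    hence "card {k \<in> {1..N}. \<not> ?err k \<le> R lam / sqrt 2} \<le> m" using \<omega> by simp
    from median_rule_error[OF N this]
    show "ereal (cmod (Int_d d f - median_rule d N \<omega> f)) \<le> ereal (R lam)" by simp
  qed
  have "1 - measure_pmf.prob (sample_pmf N n d) {\<omega>. card {k \<in> {1..N}. bad (\<omega> k)} > m}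
     = measure_pmf.prob (sample_pmf N n d) (- {\<omega>. card {k \<in> {1..N}. bad (\<omega> k)} > m})"
    using measure_pmf.prob_compl[of "{\<omega>. card {k \<in> {1..N}. bad (\<omega> k)} > m}" "sample_pmf N n d"]
    by (simp add: Compl_eq_Diff_UNIV)
  also have "\<dots> \<le> measure_pmf.prob (sample_pmf N n d)
      {\<omega>. e_det d \<alpha> \<gamma> (median_rule d N \<omega>) \<le> (INF lam\<in>{1/2..<\<alpha>}. ereal (R lam))}"
    using good by (intro measure_pmf.finite_measure_mono) auto
  finally show ?thesis using tail unfolding R_def N_def by linarith
qed

end
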